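(* Let $\Gamma$ be a unicyclic signed graph of order $n\ge 5$. Then $\eta(\Gamma)=n-5$ if and only if $\Gamma$ is one of the following signed graphs of order $n$: - the cycle $C_5$ (with arbitrary signs); - a signed graph (with arbitrary signs) whose underlying graph is $U_4(r)$ for some integer $r\ge1$.
   Context: A signed graph $\Gamma=(G,\sigma)$ consists of a finite simple graph $G=(V,E)$ (its underlying graph) and a map $\sigma:E\to\{+,-\}$. Its adjacency matrix is $A(\Gamma)=(a_{ij}^\sigma)$ with $a_{ij}^\sigma=\sigma(v_iv_j)a_{ij}$ (i.e. $\pm1$ according to the sign of the edge $v_iv_j$, and $0$ if $v_i,v_j$ are not adjacent), where $(a_{ij})$ is the adjacency matrix of $G$. The nullity $\eta(\Gamma)$ is the multiplicity of the eigenvalue $0$ of $A(\Gamma)$. The order is the number of vertices. A signed graph is unicyclic if its underlying graph is connected and contains exactly one cycle. $C_m$ denotes the cycle of order $m$, and $K_{1,m}$ the star with $m$ edges (order $m+1$). For an integer $r\ge1$, $U_4(r)$ is the graph obtained from a triangle by identifying one vertex of the triangle with a pendant (degree-one) vertex of a star $K_{1,r+1}$. *)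

theory Defs
  imports "Jordan_Normal_Form.Char_Poly"
begin

record 'a ugraph =
  verts :: "'a set"
  edges :: "'a set set"

definition simple_graph :: "'a ugraph \<Rightarrow> bool" where
  "simple_graph G \<longleftrightarrow> finite (verts G) \<and>
     (\<forall>e \<in> edges G. \<exists>u \<in> verts G. \<exists>v \<in> verts G. u \<noteq> v \<and> e = {u, v})"

definition subgraph_of :: "'a ugraph \<Rightarrow> 'a ugraph \<Rightarrow> bool" where
  "subgraph_of H G \<longleftrightarrow> simple_graph H \<and> verts H \<subseteq> verts G \<and> edges H \<subseteq> edges G"

definition graph_iso :: "'a ugraph \<Rightarrow> 'b ugraph \<Rightarrow> bool" where
  "graph_iso G H \<longleftrightarrow> (\<exists>f. bij_betw f (verts G) (verts H) \<and>
     (\<forall>u \<in> verts G. \<forall>v \<in> verts G. {u, v} \<in> edges G \<longleftrightarrow> {f u, f v} \<in> edges H))"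

definition connected_graph :: "'a ugraph \<Rightarrow> bool" where
  "connected_graph G \<longleftrightarrow> verts G \<noteq> {} \<and>
     (\<forall>u \<in> verts G. \<forall>v \<in> verts G. (u, v) \<in> {(x, y). {x, y} \<in> edges G}\<^sup>*)"

text \<open>The graph \<open>C\<^sub>m\<close>; only meaningful for \<open>m \<ge> 3\<close>.\<close>

definition cycle_graph :: "nat \<Rightarrow> nat ugraph" where
  "cycle_graph m = \<lparr>verts = {0..<m}, edges = {{i, Suc i mod m} | i. i < m}\<rparr>"

text \<open>The star \<open>K\<^sub>1\<^sub>,\<^sub>m\<close> with centre \<open>0\<close> and leaves \<open>1, \<dots>, m\<close>.\<close>

definition star_graph :: "nat \<Rightarrow> nat ugraph" where
  "star_graph m = \<lparr>verts = {0..m}, edges = {{0, i} | i. 1 \<le> i \<and> i \<le> m}\<rparr>"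

text \<open>The disjoint union of \<open>G\<close> and \<open>H\<close> with the vertex \<open>u\<close> of \<open>G\<close> identified with the
  vertex \<open>v\<close> of \<open>H\<close>; the merged vertex is \<open>Inl u\<close>.\<close>

definition identify_vertices ::
    "'a ugraph \<Rightarrow> 'a \<Rightarrow> 'b ugraph \<Rightarrow> 'b \<Rightarrow> ('a + 'b) ugraph" where
  "identify_vertices G u H v =
     (let g = (\<lambda>y. if y = v then Inl u else Inr y)
      in \<lparr>verts = Inl ` verts G \<union> g ` verts H,
          edges = (\<lambda>e. Inl ` e) ` edges G \<union> (\<lambda>e. g ` e) ` edges H\<rparr>)"

text \<open>By symmetry it does not matter which vertex of the triangle and which leaf of the star
  are merged. For \<open>r \<ge> 1\<close> the leaves of the star are exactly its pendant vertices.\<close>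

definition U4 :: "nat \<Rightarrow> (nat + nat) ugraph" where
  "U4 r = identify_vertices (cycle_graph 3) 0 (star_graph (r + 1)) 1"

datatype sign = Pos | Neg

primrec sign_val :: "sign \<Rightarrow> real" where
  "sign_val Pos = 1"
| "sign_val Neg = -1"

text \<open>Only the values of \<open>edge_sign\<close> on the edges of the underlying graph are ever used.\<close>

record 'a signed_graph =
  underlying :: "'a ugraph"
  edge_sign :: "'a set \<Rightarrow> sign"

definition signed_graph :: "'a signed_graph \<Rightarrow> bool" where
  "signed_graph \<Gamma> \<longleftrightarrow> simple_graph (underlying \<Gamma>)"

definition graph_order :: "'a signed_graph \<Rightarrow> nat" where
  "graph_order \<Gamma> = card (verts (underlying \<Gamma>))"

definition unicyclic :: "'a signed_graph \<Rightarrow> bool" where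
  "unicyclic \<Gamma> \<longleftrightarrow> connected_graph (underlying \<Gamma>) \<and>
     (\<exists>!C. subgraph_of C (underlying \<Gamma>) \<and> (\<exists>m \<ge> 3. graph_iso C (cycle_graph m)))"

text \<open>The adjacency matrix with respect to an enumeration \<open>vs\<close> of the vertices.\<close>

definition adjacency_matrix :: "'a list \<Rightarrow> 'a signed_graph \<Rightarrow> real mat" where
  "adjacency_matrix vs \<Gamma> = mat (length vs) (length vs)
     (\<lambda>(i, j). if {vs ! i, vs ! j} \<in> edges (underlying \<Gamma>)
               then sign_val (edge_sign \<Gamma> {vs ! i, vs ! j}) else 0)"

text \<open>The multiplicity of the eigenvalue \<open>0\<close>. The enumeration of the vertices is chosen
  arbitrarily; lemma \<open>nullity_eq\<close> shows that the choice is immaterial.\<close>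

definition nullity :: "'a signed_graph \<Rightarrow> nat" where
  "nullity \<Gamma> = Polynomial.order 0
     (char_poly (adjacency_matrix (SOME vs. distinct vs \<and> set vs = verts (underlying \<Gamma>)) \<Gamma>))"

lemma char_poly_adjacency_cong:
  assumes "distinct vs" "distinct ws" "set vs = set ws"
  shows "char_poly (adjacency_matrix vs \<Gamma>) = char_poly (adjacency_matrix ws \<Gamma>)"
proof -
  define n where "n = length vs"
  have lw: "length ws = n"
    using assms distinct_card[of vs] distinct_card[of ws] by (simp add: n_def)
  define a where "a = (\<lambda>x y. if {x, y} \<in> edges (underlying \<Gamma>)
               then sign_val (edge_sign \<Gamma> {x, y}) else 0)"
  define P where "P = (\<lambda>xs ys. mat n n (\<lambda>(i, j). if xs ! i = (ys ! j :: 'a) then 1 else (0 :: real)))"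
  have A: "adjacency_matrix xs \<Gamma> = mat n n (\<lambda>(i, j). a (xs ! i) (xs ! j))" if "length xs = n" for xs
    using that by (auto simp: adjacency_matrix_def a_def intro!: eq_matI)
  have reindex: "(\<Sum>k<n. f (xs ! k)) = sum f (set xs)" if "distinct xs" "length xs = n"
    for xs :: "'a list" and f :: "'a \<Rightarrow> real"
    using that by (intro sum.reindex_bij_betw bij_betw_nth) auto
  have PP: "P xs ys * P ys xs = 1\<^sub>m n"
    if "distinct xs" "distinct ys" "set xs = set ys" "length xs = n" "length ys = n" for xs ys
  proof (rule eq_matI)
    fix i j assume "i < dim_row (1\<^sub>m n)" "j < dim_col (1\<^sub>m n)"
    hence ij: "i < n" "j < n" by auto
    have "(P xs ys * P ys xs) $$ (i, j) =
        (\<Sum>k<n. (if xs ! i = ys ! k then 1 else 0) * (if ys ! k = xs ! j then 1 else 0))"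
      using ij by (simp add: P_def scalar_prod_def lessThan_atLeast0)
    also have "\<dots> = (\<Sum>y\<in>set ys. (if xs ! i = y then 1 else 0) * (if y = xs ! j then 1 else 0))"
      using that by (intro reindex) auto
    also have "\<dots> = (\<Sum>y\<in>set ys. if y = xs ! i then (if y = xs ! j then 1 else 0) else 0)"
      by (intro sum.cong) auto
    also have "\<dots> = (if xs ! i = xs ! j then 1 else 0)"
      using that ij by (subst sum.delta) (auto simp flip: \<open>set xs = set ys\<close>)
    finally show "(P xs ys * P ys xs) $$ (i, j) = 1\<^sub>m n $$ (i, j)"
      using that ij by (simp add: nth_eq_iff_index_eq)
  qed (auto simp: P_def)
  have PA: "adjacency_matrix vs \<Gamma> = P vs ws * adjacency_matrix ws \<Gamma> * P ws vs"
  proof (rule eq_matI)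
    fix i j
    assume "i < dim_row (P vs ws * adjacency_matrix ws \<Gamma> * P ws vs)"
      "j < dim_col (P vs ws * adjacency_matrix ws \<Gamma> * P ws vs)"
    hence ij: "i < n" "j < n" by (auto simp: P_def)
    have *: "(P vs ws * adjacency_matrix ws \<Gamma>) $$ (i, k) = a (vs ! i) (ws ! k)" if "k < n" for k
    proof -
      have "(P vs ws * adjacency_matrix ws \<Gamma>) $$ (i, k) =
          (\<Sum>l<n. (if vs ! i = ws ! l then 1 else 0) * a (ws ! l) (ws ! k))"
        using ij that lw by (simp add: P_def A scalar_prod_def lessThan_atLeast0)
      also have "\<dots> = (\<Sum>y\<in>set ws. (if vs ! i = y then 1 else 0) * a y (ws ! k))"
        using assms lw by (intro reindex) auto
      also have "\<dots> = (\<Sum>y\<in>set ws. if y = vs ! i then a y (ws ! k) else 0)"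
        by (intro sum.cong) auto
      also have "\<dots> = a (vs ! i) (ws ! k)"
        using ij by (subst sum.delta) (auto simp flip: assms(3) simp: n_def)
      finally show ?thesis .
    qed
    have "(P vs ws * adjacency_matrix ws \<Gamma> * P ws vs) $$ (i, j) =
        (\<Sum>k<n. (P vs ws * adjacency_matrix ws \<Gamma>) $$ (i, k) * P ws vs $$ (k, j))"
      using ij lw by (simp add: P_def A scalar_prod_def lessThan_atLeast0)
    also have "\<dots> = (\<Sum>k<n. a (vs ! i) (ws ! k) * (if ws ! k = vs ! j then 1 else 0))"
      using ij by (intro sum.cong) (simp_all add: *, simp add: P_def)
    also have "\<dots> = (\<Sum>y\<in>set ws. a (vs ! i) y * (if y = vs ! j then 1 else 0))"
      using assms lw by (intro reindex) auto
    also have "\<dots> = (\<Sum>y\<in>set ws. if y = vs ! j then a (vs ! i) y else 0)"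
      by (intro sum.cong) auto
    also have "\<dots> = a (vs ! i) (vs ! j)"
      using ij by (subst sum.delta) (auto simp flip: assms(3) simp: n_def)
    finally show "adjacency_matrix vs \<Gamma> $$ (i, j) = (P vs ws * adjacency_matrix ws \<Gamma> * P ws vs) $$ (i, j)"
      using ij by (simp add: A n_def)
  qed (auto simp: P_def A n_def)
  have "similar_mat (adjacency_matrix vs \<Gamma>) (adjacency_matrix ws \<Gamma>)"
    unfolding similar_mat_def
    by (intro exI[of _ "P vs ws"] exI[of _ "P ws vs"], rule similar_mat_witI[where n = n])
       (use assms lw PP PA in \<open>auto simp: n_def A P_def\<close>)
  thus ?thesis by (rule char_poly_similar)
qed

lemma nullity_eq:
  assumes "distinct vs" "set vs = verts (underlying \<Gamma>)"
  shows "nullity \<Gamma> = Polynomial.order 0 (char_poly (adjacency_matrix vs \<Gamma>))"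
proof -
  let ?ws = "SOME ws. distinct ws \<and> set ws = verts (underlying \<Gamma>)"
  have "distinct ?ws \<and> set ?ws = verts (underlying \<Gamma>)"
    by (rule someI[of _ vs]) (use assms in simp)
  thus ?thesis
    using assms char_poly_adjacency_cong[of vs ?ws \<Gamma>] by (simp add: nullity_def)
qed

end

theory Submission
  imports Defs
begin

text \<open>
  The adjacency matrix \<open>A\<close> is real symmetric, so \<open>n - \<eta>(\<Gamma>)\<close> is its rank, and the claim says which
  unicyclic signed graphs have rank \<open>5\<close>. Three estimates decide this.

  \<^item> A nonsingular principal submatrix of size \<open>s\<close> forces rank at least \<open>s\<close>
    (\<open>nullity_le_of_nonsingular_on\<close>). Such submatrices arise by adding a pendant edge to a smaller
    one (\<open>nonsingular_on_pendant\<close>), from the empty one or from the odd cycle itself, which is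
    nonsingular for every choice of signs (\<open>nonsingular_on_odd_cycle\<close>).
  \<^item> A factorization of \<open>A\<close> through \<open>s\<close> dimensions forces rank at most \<open>s\<close>
    (\<open>nullity_ge_of_factorization\<close>); a vertex cover of size \<open>w\<close> gives one with \<open>s = 2 * w\<close>.
  \<^item> A bipartite graph has even rank (\<open>nullity_parity_of_bipartite\<close>).

  Let \<open>k\<close> be the length of the cycle. If \<open>k\<close> is even, the graph is bipartite and its rank is not \<open>5\<close>.
  If \<open>k\<close> is odd and at least \<open>7\<close>, the cycle contains an induced path on six vertices, which peels
  off as three pendant edges, so the rank is at least \<open>6\<close>. The same happens for \<open>k = 5\<close> as soon as
  a vertex is attached to the cycle, so only \<open>C\<^sub>5\<close> remains there, and its rank is \<open>5\<close>.

  For \<open>k = 3\<close> (\<open>triangle_trichotomy\<close>) consider the distances to the triangle. A vertex at distance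
  \<open>3\<close>, or one at distance \<open>2\<close> together with two vertices at distance \<open>1\<close>, again yields three pendant
  edges that peel off. If vertices at distance \<open>2\<close> exist and only one vertex has distance \<open>1\<close>, the graph
  is \<open>U4 r\<close>. If nothing is at distance \<open>2\<close>, then either every triangle vertex carries a pendant vertex,
  which gives rank at least \<open>6\<close>, or two triangle vertices cover all edges, which gives rank at most \<open>4\<close>.
  Finally \<open>U4 r\<close> has rank exactly \<open>5\<close>: the triangle together with one pendant edge is
  nonsingular, and all leaves have proportional rows (\<open>nullity_of_U4_shaped\<close>).
\<close>

section \<open>Characteristic polynomials and kernels of real matrices\<close>

lemma poly_char_poly_real:
  fixes A :: "real mat"
  assumes "A \<in> carrier_mat n n"
  shows "poly (char_poly A) x = det (x \<cdot>\<^sub>m 1\<^sub>m n - A)"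
proof -
  have "- char_matrix A x = x \<cdot>\<^sub>m 1\<^sub>m n - A"
    using assms by (intro eq_matI) (auto simp: char_matrix_def)
  then show ?thesis using char_poly_matrix[OF assms, of x] by simp
qed

text \<open>The block matrix with rows \<open>(x I, C)\<close> and \<open>(F, I)\<close> can be made block triangular by a column
  operation, which exposes \<open>x I - C F\<close>, or by a row operation, which exposes \<open>x I - F C\<close>. Its
  determinant is computed both ways.\<close>

lemma det_minus_mult_commute:
  fixes C F :: "real mat"
  assumes C: "C \<in> carrier_mat n k" and F: "F \<in> carrier_mat k n"
  shows "x ^ k * det (x \<cdot>\<^sub>m 1\<^sub>m n - C * F) = x ^ n * det (x \<cdot>\<^sub>m 1\<^sub>m k - F * C)"
proof -
  let ?M = "four_block_mat (x \<cdot>\<^sub>m 1\<^sub>m n) C F (1\<^sub>m k)"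
  let ?X = "four_block_mat (1\<^sub>m n) (0\<^sub>m n k) (- F) (1\<^sub>m k)"
  let ?Y = "four_block_mat (1\<^sub>m n) (0\<^sub>m n k) (- F) (x \<cdot>\<^sub>m 1\<^sub>m k)"
  have M: "?M \<in> carrier_mat (n + k) (n + k)" and X: "?X \<in> carrier_mat (n + k) (n + k)"
    and Y: "?Y \<in> carrier_mat (n + k) (n + k)"
    by (rule four_block_carrier_mat; simp)+
  have CF: "C * F \<in> carrier_mat n n" and FC: "F * C \<in> carrier_mat k k"
    using C F by auto
  have MX: "?M * ?X = four_block_mat (x \<cdot>\<^sub>m 1\<^sub>m n - C * F) C (0\<^sub>m k n) (1\<^sub>m k)"
    by (subst mult_four_block_mat[of _ n n _ k _ k _ _ n _ k])
       (use C F CF FC in \<open>auto intro!: cong_four_block_mat eq_matI\<close>)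
  have YM: "?Y * ?M = four_block_mat (x \<cdot>\<^sub>m 1\<^sub>m n) C (0\<^sub>m k n) (x \<cdot>\<^sub>m 1\<^sub>m k - F * C)"
    by (subst mult_four_block_mat[of _ n n _ k _ k _ _ n _ k])
       (use C F CF FC in \<open>auto intro!: cong_four_block_mat\<close>)
  have D: "x \<cdot>\<^sub>m 1\<^sub>m n - C * F \<in> carrier_mat n n" "x \<cdot>\<^sub>m 1\<^sub>m k - F * C \<in> carrier_mat k k"
    "- F \<in> carrier_mat k n" "x \<cdot>\<^sub>m 1\<^sub>m n \<in> carrier_mat n n"  "x \<cdot>\<^sub>m 1\<^sub>m k \<in> carrier_mat k k"
    using F CF FC by (auto intro!: minus_carrier_mat)
  have detX: "det ?X = 1" and detY: "det ?Y = x ^ k"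
    using det_four_block_mat_upper_right_zero[OF one_carrier_mat refl D(3) one_carrier_mat]
      det_four_block_mat_upper_right_zero[OF one_carrier_mat refl D(3) D(5)] by simp_all
  have "det ?M * det ?X = det (?M * ?X)" by (rule det_mult[OF M X, symmetric])
  then have 1: "det ?M = det (x \<cdot>\<^sub>m 1\<^sub>m n - C * F)"
    unfolding MX detX det_four_block_mat_lower_left_zero[OF D(1) C refl one_carrier_mat] by simp
  have "x ^ k * det ?M = det (?Y * ?M)"
    using det_mult[OF Y M] unfolding detY by simp
  also have "\<dots> = x ^ n * det (x \<cdot>\<^sub>m 1\<^sub>m k - F * C)"
    unfolding YM det_four_block_mat_lower_left_zero[OF D(4) C refl D(2)] by simp
  finally show ?thesis using 1 by simp
qed

lemma char_poly_mult_commute: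
  fixes C F :: "real mat"
  assumes C: "C \<in> carrier_mat n k" and F: "F \<in> carrier_mat k n"
  shows "[:0, 1:] ^ k * char_poly (C * F) = [:0, 1:] ^ n * char_poly (F * C)"
proof -
  have "C * F \<in> carrier_mat n n" "F * C \<in> carrier_mat k k" using assms by auto
  then have "poly ([:0, 1:] ^ k * char_poly (C * F)) = poly ([:0, 1:] ^ n * char_poly (F * C))"
    using det_minus_mult_commute[OF assms]
    by (intro ext) (simp add: poly_char_poly_real)
  then show ?thesis by (simp only: poly_eq_poly_eq_iff)
qed

text \<open>Compare the orders at \<open>0\<close> of the two sides of the previous identity. This bounds the multiplicity of
  the eigenvalue \<open>0\<close> from below by the corank.\<close>

lemma order_zero_ge_of_factorization:
  fixes C F :: "real mat"
  assumes C: "C \<in> carrier_mat n k" and F: "F \<in> carrier_mat k n"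
  shows "n \<le> order 0 (char_poly (C * F)) + k"
proof -
  have CF: "C * F \<in> carrier_mat n n" and FC: "F * C \<in> carrier_mat k k" using assms by auto
  have nz: "char_poly (C * F) \<noteq> 0" "char_poly (F * C) \<noteq> 0"
    using degree_monic_char_poly[OF CF] degree_monic_char_poly[OF FC] by auto
  have o: "order 0 ([:0, 1:] ^ m :: real poly) = m" for m
    using order_power_n_n[of "0::real" m] by simp
  have "order 0 ([:0, 1:] ^ k * char_poly (C * F)) = order 0 ([:0, 1:] ^ n * char_poly (F * C))"
    by (simp add: char_poly_mult_commute[OF C F])
  then show ?thesis using nz by (simp add: order_mult o)
qed

lemma smult_mat_one_mult:
  assumes "M \<in> carrier_mat n m"
  shows "(x \<cdot>\<^sub>m 1\<^sub>m n) * M = (x :: real) \<cdot>\<^sub>m M"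
  using mult_smult_assoc_mat[of "1\<^sub>m n" n n M m x] assms by simp

text \<open>Adding \<open>v v\<^sup>T\<close> for a unit vector \<open>v\<close> in the kernel moves one eigenvalue from \<open>0\<close> to \<open>1\<close>: since
  \<open>A v = 0\<close>, the product \<open>(x I - A) (x I - v v\<^sup>T)\<close> equals \<open>x (x I - A - v v\<^sup>T)\<close>.\<close>

lemma order_zero_deflation:
  fixes A :: "real mat" and v :: "real vec"
  assumes A: "A \<in> carrier_mat n n" and v: "v \<in> carrier_vec n"
    and ker: "A *\<^sub>v v = 0\<^sub>v n" and unit: "v \<bullet> v = 1"
  defines "B \<equiv> mat n n (\<lambda>(i, j). A $$ (i, j) + v $ i * v $ j)"
  shows "order 0 (char_poly A) = Suc (order 0 (char_poly B))"
proof -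
  define C where "C = mat n 1 (\<lambda>(i, j). v $ i)"
  define F where "F = mat 1 n (\<lambda>(i, j). v $ j)"
  have C: "C \<in> carrier_mat n 1" and F: "F \<in> carrier_mat 1 n" by (auto simp: C_def F_def)
  have CF: "C * F \<in> carrier_mat n n" and B: "B \<in> carrier_mat n n"
    using C F by (auto simp: B_def)
  have CFij: "(C * F) $$ (i, j) = v $ i * v $ j" if "i < n" "j < n" for i j
    using that by (simp add: C_def F_def scalar_prod_def)
  have FC: "F * C = 1\<^sub>m 1"
    using unit v by (intro eq_matI) (auto simp: C_def F_def scalar_prod_def)
  have AC: "A * C = 0\<^sub>m n 1"
  proof (rule eq_matI)
    fix i j assume "i < dim_row (0\<^sub>m n 1 :: real mat)" "j < dim_col (0\<^sub>m n 1 :: real mat)"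
    then have i: "i < n" "j = 0" by auto
    have "(A * C) $$ (i, j) = (A *\<^sub>v v) $ i"
      using i A v by (auto simp: C_def scalar_prod_def)
    then show "(A * C) $$ (i, j) = 0\<^sub>m n 1 $$ (i, j)" using ker i by simp
  qed (use A C in auto)
  have ACF: "A * (C * F) = 0\<^sub>m n n"
    using assoc_mult_mat[OF A C F] AC F by simp
  have key: "(x - 1) * det (x \<cdot>\<^sub>m 1\<^sub>m n - A) * x ^ n = x * det (x \<cdot>\<^sub>m 1\<^sub>m n - B) * x ^ n" for x
  proof -
    have "det (x \<cdot>\<^sub>m 1\<^sub>m n - A) * det (x \<cdot>\<^sub>m 1\<^sub>m n - C * F)
        = det ((x \<cdot>\<^sub>m 1\<^sub>m n - A) * (x \<cdot>\<^sub>m 1\<^sub>m n - C * F))"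
      by (rule det_mult[symmetric]) (use A CF in \<open>auto intro!: minus_carrier_mat\<close>)
    also have "(x \<cdot>\<^sub>m 1\<^sub>m n - A) * (x \<cdot>\<^sub>m 1\<^sub>m n - C * F) = x \<cdot>\<^sub>m (x \<cdot>\<^sub>m 1\<^sub>m n - B)"
    proof -
      have "(x \<cdot>\<^sub>m 1\<^sub>m n - A) * (x \<cdot>\<^sub>m 1\<^sub>m n - C * F)
          = (x \<cdot>\<^sub>m 1\<^sub>m n - A) * (x \<cdot>\<^sub>m 1\<^sub>m n) - (x \<cdot>\<^sub>m 1\<^sub>m n - A) * (C * F)"
        by (rule mult_minus_distrib_mat[where n = n]) (use A CF in auto)
      also have "(x \<cdot>\<^sub>m 1\<^sub>m n - A) * (C * F) = x \<cdot>\<^sub>m 1\<^sub>m n * (C * F) - A * (C * F)"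
        by (rule minus_mult_distrib_mat[where nr = n and n = n]) (use A CF in auto)
      also have "\<dots> = x \<cdot>\<^sub>m (C * F)"
        unfolding ACF smult_mat_one_mult[OF CF] using C F
        by (intro eq_matI) (auto simp del: index_mult_mat(1))
      also have "(x \<cdot>\<^sub>m 1\<^sub>m n - A) * (x \<cdot>\<^sub>m 1\<^sub>m n) = x \<cdot>\<^sub>m (x \<cdot>\<^sub>m 1\<^sub>m n - A)"
        using mult_smult_distrib[of "x \<cdot>\<^sub>m 1\<^sub>m n - A" n n "1\<^sub>m n" n x] A
        by (metis minus_carrier_mat one_carrier_mat right_mult_one_mat)
      also have "x \<cdot>\<^sub>m (x \<cdot>\<^sub>m 1\<^sub>m n - A) - x \<cdot>\<^sub>m (C * F) = x \<cdot>\<^sub>m (x \<cdot>\<^sub>m 1\<^sub>m n - B)"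
        using A B CF CFij by (intro eq_matI) (auto simp: B_def algebra_simps simp del: index_mult_mat)
      finally show ?thesis .
    qed
    also have "det \<dots> = x ^ n * det (x \<cdot>\<^sub>m 1\<^sub>m n - B)" using B by simp
    finally have *: "det (x \<cdot>\<^sub>m 1\<^sub>m n - A) * det (x \<cdot>\<^sub>m 1\<^sub>m n - C * F) = x ^ n * det (x \<cdot>\<^sub>m 1\<^sub>m n - B)" .
    have "x * det (x \<cdot>\<^sub>m 1\<^sub>m n - C * F) = x ^ n * det (x \<cdot>\<^sub>m 1\<^sub>m 1 - 1\<^sub>m 1)"
      using det_minus_mult_commute[OF C F, of x] by (simp add: FC)
    also have "x \<cdot>\<^sub>m 1\<^sub>m 1 - 1\<^sub>m 1 = (x - 1) \<cdot>\<^sub>m 1\<^sub>m 1" by (intro eq_matI) auto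
    finally have "x * det (x \<cdot>\<^sub>m 1\<^sub>m n - C * F) = x ^ n * (x - 1)" by simp
    with * show ?thesis by (metis (no_types, lifting) mult.assoc mult.commute)
  qed
  have "poly ([:-1, 1:] * char_poly A * [:0, 1:] ^ n) = poly ([:0, 1:] * char_poly B * [:0, 1:] ^ n)"
    using key by (intro ext) (simp add: poly_char_poly_real[OF A] poly_char_poly_real[OF B] algebra_simps)
  then have "[:-1, 1:] * char_poly A * [:0, 1:] ^ n = [:0, 1:] * char_poly B * [:0, 1:] ^ n"
    by (simp only: poly_eq_poly_eq_iff)
  then have eq: "[:-1, 1:] * char_poly A = [:0, 1:] * char_poly B"
    by (subst (asm) mult_right_cancel) simp_all
  have nz: "char_poly A \<noteq> 0" "char_poly B \<noteq> 0"
    using degree_monic_char_poly[OF A] degree_monic_char_poly[OF B] by auto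
  have "order 0 ([:-1, 1:] * char_poly A) = order 0 (char_poly A)"
  proof -
    have "order 0 [:-1, 1::real:] = 0" by (rule order_0I) simp
    then show ?thesis using nz by (subst order_mult) (auto simp del: mult_pCons_left)
  qed
  moreover have "order 0 ([:0, 1:] * char_poly B) = Suc (order 0 (char_poly B))"
    using nz order_power_n_n[of "0::real" 1] by (subst order_mult) (auto simp del: mult_pCons_left)
  ultimately show ?thesis using eq by simp
qed

text \<open>For a symmetric matrix the algebraic multiplicity of \<open>0\<close> does not exceed the geometric one. Deflation
  by a unit kernel vector \<open>v\<close> lowers the multiplicity by one and keeps symmetry; symmetry also makes
  every kernel vector of \<open>A + v v\<^sup>T\<close> orthogonal to \<open>v\<close> and hence a kernel vector of \<open>A\<close>, so the vectors
  found for the deflated matrix can be extended by \<open>v\<close>.\<close>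

lemma symmetric_orthonormal_kernel:
  fixes A :: "real mat"
  assumes "A \<in> carrier_mat n n" and "\<And>i j. i < n \<Longrightarrow> j < n \<Longrightarrow> A $$ (i, j) = A $$ (j, i)"
    and "order 0 (char_poly A) = N"
  shows "\<exists>w :: nat \<Rightarrow> real vec. (\<forall>i<N. w i \<in> carrier_vec n \<and> A *\<^sub>v w i = 0\<^sub>v n) \<and>
    (\<forall>i<N. \<forall>j<N. w i \<bullet> w j = (if i = j then 1 else 0))"
  using assms
proof (induction N arbitrary: A)
  case 0
  then show ?case by simp
next
  case (Suc N)
  note A = Suc.prems(1)
  have "poly (char_poly A) 0 = 0"
    using Suc.prems(3) order_root[of "char_poly A" 0] by auto
  then have "eigenvalue A 0" using eigenvalue_root_char_poly[OF A] by simp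
  then obtain u where u: "u \<in> carrier_vec n" "u \<noteq> 0\<^sub>v n" "A *\<^sub>v u = 0 \<cdot>\<^sub>v u"
    using A by (auto simp: eigenvalue_def eigenvector_def)
  have upos: "u \<bullet> u > 0"
  proof -
    obtain i where "i < n" "u $ i \<noteq> 0"
      using u(1,2) by (metis carrier_vecD eq_vecI index_zero_vec)
    then have "0 < (\<Sum>i\<in>{0..<n}. u $ i * u $ i)"
      by (intro sum_pos2[of _ i]) (auto simp: zero_less_mult_iff)
    then show ?thesis using u(1) by (simp add: scalar_prod_def)
  qed
  define v where "v = (1 / sqrt (u \<bullet> u)) \<cdot>\<^sub>v u"
  have v: "v \<in> carrier_vec n" "v \<bullet> v = 1" "A *\<^sub>v v = 0\<^sub>v n"
    using u upos A by (auto simp: v_def mult_mat_vec intro!: eq_vecI)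
  define B where "B = mat n n (\<lambda>(i, j). A $$ (i, j) + v $ i * v $ j)"
  have B: "B \<in> carrier_mat n n" by (simp add: B_def)
  have "order 0 (char_poly B) = N"
    using order_zero_deflation[OF A v(1,3,2), folded B_def] Suc.prems(3) by simp
  moreover have "B $$ (i, j) = B $$ (j, i)" if "i < n" "j < n" for i j
    using that Suc.prems(2) by (simp add: B_def)
  ultimately obtain w where w: "\<And>i. i < N \<Longrightarrow> w i \<in> carrier_vec n"
    "\<And>i. i < N \<Longrightarrow> B *\<^sub>v w i = 0\<^sub>v n"
    "\<And>i j. i < N \<Longrightarrow> j < N \<Longrightarrow> w i \<bullet> w j = (if i = j then 1 else 0)"
    using Suc.IH[OF B] by blast
  have Bx: "B *\<^sub>v x = A *\<^sub>v x + (v \<bullet> x) \<cdot>\<^sub>v v" if x: "x \<in> carrier_vec n" for x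
  proof (rule eq_vecI)
    fix i assume "i < dim_vec (A *\<^sub>v x + (v \<bullet> x) \<cdot>\<^sub>v v)"
    then have i: "i < n" using v by auto
    then show "(B *\<^sub>v x) $ i = (A *\<^sub>v x + (v \<bullet> x) \<cdot>\<^sub>v v) $ i"
      using A v(1) x
      by (simp add: B_def scalar_prod_def sum.distrib sum_distrib_left sum_distrib_right algebra_simps)
  qed (use B v in auto)
  have At: "transpose_mat A = A"
    using A Suc.prems(2) by (intro eq_matI) auto
  have vA: "v \<bullet> (A *\<^sub>v x) = 0" if x: "x \<in> carrier_vec n" for x
    using transpose_vec_mult_scalar[OF A x v(1)] v x by (simp add: At)
  have vw: "v \<bullet> w i = 0" if i: "i < N" for i
  proof -
    have "0 = v \<bullet> (A *\<^sub>v w i + (v \<bullet> w i) \<cdot>\<^sub>v v)"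
      using v(1) by (simp flip: Bx[OF w(1)[OF i]] add: w(2)[OF i])
    also have "\<dots> = v \<bullet> (A *\<^sub>v w i) + v \<bullet> ((v \<bullet> w i) \<cdot>\<^sub>v v)"
      by (rule scalar_prod_add_distrib) (use v A w(1)[OF i] in auto)
    also have "\<dots> = v \<bullet> w i" using v vA[OF w(1)[OF i]] by simp
    finally show ?thesis by simp
  qed
  have Aw: "A *\<^sub>v w i = 0\<^sub>v n" if i: "i < N" for i
    using Bx[OF w(1)[OF i]] w(2)[OF i] vw[OF i] v A by auto
  define w' where "w' i = (case i of 0 \<Rightarrow> v | Suc j \<Rightarrow> w j)" for i
  have "w' i \<in> carrier_vec n \<and> A *\<^sub>v w' i = 0\<^sub>v n" if "i < Suc N" for i
    using that v w Aw by (cases i) (auto simp: w'_def)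
  moreover have "w' i \<bullet> w' j = (if i = j then 1 else 0)" if "i < Suc N" "j < Suc N" for i j
  proof -
    have "w k \<bullet> v = 0" if "k < N" for k
      using vw[OF that] comm_scalar_prod[OF v(1) w(1)[OF that]] by simp
    then show ?thesis
      using that v w vw by (cases i; cases j) (auto simp: w'_def)
  qed
  ultimately show ?case by blast
qed

lemma underdetermined_system_real:
  fixes f :: "nat \<Rightarrow> nat \<Rightarrow> real"
  assumes "m < N"
  shows "\<exists>y. (\<exists>j<N. y j \<noteq> 0) \<and> (\<forall>i<m. (\<Sum>j<N. f i j * y j) = 0)"
proof -
  define M where "M = mat N N (\<lambda>(i, j). if i < m then f i j else 0)"
  have M: "M \<in> carrier_mat N N" by (simp add: M_def)
  \<comment> \<open>The system is padded with zero rows to a square one, whose determinant vanishes.\<close>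
  have "row M m = 0\<^sub>v N" using assms by (intro eq_vecI) (auto simp: M_def)
  then have "det M = 0"
    using laplace_expansion_row[OF M assms] assms
    by (simp add: M_def)
  then obtain v where v: "v \<in> carrier_vec N" "v \<noteq> 0\<^sub>v N" "M *\<^sub>v v = 0\<^sub>v N"
    using det_0_iff_vec_prod_zero_field[OF M] by auto
  have "\<exists>j<N. v $ j \<noteq> 0" using v(1,2) by (auto intro!: eq_vecI)
  moreover have "(\<Sum>j<N. f i j * v $ j) = 0" if "i < m" for i
  proof -
    have "(M *\<^sub>v v) $ i = (\<Sum>j<N. f i j * v $ j)"
      using that assms v(1) by (simp add: M_def scalar_prod_def lessThan_atLeast0)
    then show ?thesis using v(3) that assms by simp
  qed
  ultimately show ?thesis by blast
qed

section \<open>Nullity of a signed graph\<close>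

definition weight :: "'a signed_graph \<Rightarrow> 'a \<Rightarrow> 'a \<Rightarrow> real" where
  "weight \<Gamma> u v = (if {u, v} \<in> edges (underlying \<Gamma>) then sign_val (edge_sign \<Gamma> {u, v}) else 0)"

lemma weight_commute: "weight \<Gamma> u v = weight \<Gamma> v u"
  by (simp add: weight_def insert_commute)

lemma sign_val_square: "sign_val s * sign_val s = 1"
  by (cases s) auto

lemma weight_square: "{u, v} \<in> edges (underlying \<Gamma>) \<Longrightarrow> weight \<Gamma> u v * weight \<Gamma> u v = 1"
  by (simp add: weight_def sign_val_square)

lemma weight_eq_0_iff: "weight \<Gamma> u v = 0 \<longleftrightarrow> {u, v} \<notin> edges (underlying \<Gamma>)"
  using weight_square[of u v \<Gamma>] by (auto simp: weight_def)

lemma signed_graph_enumeration: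
  assumes "signed_graph \<Gamma>"
  obtains vs A where "distinct vs" "set vs = verts (underlying \<Gamma>)" "length vs = graph_order \<Gamma>"
    "A \<in> carrier_mat (graph_order \<Gamma>) (graph_order \<Gamma>)"
    "\<And>i j. i < graph_order \<Gamma> \<Longrightarrow> j < graph_order \<Gamma> \<Longrightarrow> A $$ (i, j) = weight \<Gamma> (vs ! i) (vs ! j)"
    "nullity \<Gamma> = order 0 (char_poly A)"
proof -
  have "finite (verts (underlying \<Gamma>))" using assms by (simp add: signed_graph_def simple_graph_def)
  then obtain vs where vs: "distinct vs" "set vs = verts (underlying \<Gamma>)"
    using finite_distinct_list by metis
  moreover have "length vs = graph_order \<Gamma>"
    using vs distinct_card[of vs] by (simp add: graph_order_def)
  ultimately show ?thesis
    using nullity_eq[OF vs] by (intro that[of vs "adjacency_matrix vs \<Gamma>"])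
      (auto simp: adjacency_matrix_def weight_def)
qed

lemma sum_nth_enumeration:
  assumes "distinct vs" "set vs = V" "length vs = n"
  shows "(\<Sum>i<n. f (vs ! i)) = sum f V"
  using assms by (intro sum.reindex_bij_betw bij_betw_nth) auto

text \<open>The principal submatrix indexed by \<open>S\<close> is nonsingular, expressed by the triviality of its kernel so
  that no enumeration of \<open>S\<close> is needed.\<close>

definition nonsingular_on :: "'a signed_graph \<Rightarrow> 'a set \<Rightarrow> bool" where
  "nonsingular_on \<Gamma> S \<longleftrightarrow>
     (\<forall>x. (\<forall>u\<in>S. (\<Sum>v\<in>S. weight \<Gamma> u v * x v) = 0) \<longrightarrow> (\<forall>u\<in>S. x u = 0))"

text \<open>If the nullity exceeded the number of vertices outside \<open>S\<close>, some nontrivial combination of orthonormal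
  kernel vectors would vanish outside \<open>S\<close>. It would then be a kernel vector of the submatrix
  on \<open>S\<close>, hence zero.\<close>

lemma nullity_le_of_nonsingular_on:
  assumes G: "signed_graph \<Gamma>" and S: "S \<subseteq> verts (underlying \<Gamma>)" and ns: "nonsingular_on \<Gamma> S"
  shows "nullity \<Gamma> + card S \<le> graph_order \<Gamma>"
proof (rule ccontr)
  assume contr: "\<not> ?thesis"
  define n where "n = graph_order \<Gamma>"
  define V where "V = verts (underlying \<Gamma>)"
  obtain vs A where vs: "distinct vs" "set vs = V" "length vs = n"
    and A: "A \<in> carrier_mat n n"
    and Aij: "\<And>i j. i < n \<Longrightarrow> j < n \<Longrightarrow> A $$ (i, j) = weight \<Gamma> (vs ! i) (vs ! j)"
    and ord: "nullity \<Gamma> = order 0 (char_poly A)"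
    using signed_graph_enumeration[OF G] unfolding n_def V_def by metis
  define N where "N = nullity \<Gamma>"
  have finV: "finite V" using vs by auto
  have finS: "finite S" using S finV by (simp add: V_def finite_subset)
  obtain w where w: "\<And>i. i < N \<Longrightarrow> w i \<in> carrier_vec n"
    "\<And>i. i < N \<Longrightarrow> A *\<^sub>v w i = 0\<^sub>v n"
    "\<And>i j. i < N \<Longrightarrow> j < N \<Longrightarrow> w i \<bullet> w j = (if i = j then 1 else 0)"
    using symmetric_orthonormal_kernel[OF A, of N] Aij ord unfolding N_def
    by (metis weight_commute)
  define I where "I = {i. i < n \<and> vs ! i \<notin> S}"
  have "card I = card (V - S)"
  proof -
    have "(\<lambda>i. vs ! i) ` I = V - S" "inj_on (\<lambda>i. vs ! i) I"
      using vs by (auto simp: I_def in_set_conv_nth inj_on_def nth_eq_iff_index_eq)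
    then show ?thesis by (metis card_image)
  qed
  also have "\<dots> = n - card S"
    using S finS by (simp add: card_Diff_subset n_def V_def graph_order_def)
  finally have cI: "card I < N"
    using contr card_mono[OF finV, of S] S by (simp add: N_def n_def V_def graph_order_def)
  obtain h where h: "bij_betw h {0..<card I} I"
    using ex_bij_betw_nat_finite[of I] by (auto simp: I_def)
  obtain y where y: "\<exists>j<N. y j \<noteq> 0" "\<And>i. i < card I \<Longrightarrow> (\<Sum>j<N. w j $ (h i) * y j) = 0"
    using underdetermined_system_real[OF cI, of "\<lambda>i j. w j $ (h i)"] by blast
  define z where "z i = (\<Sum>j<N. w j $ i * y j)" for i
  \<comment> \<open>The kernel vector \<open>z\<close>, indexed by positions, is transported to the vertices.\<close>
  define x where "x v = z (inv_into {..<n} (\<lambda>i. vs ! i) v)" for v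
  have xz: "x (vs ! i) = z i" if "i < n" for i
    using that vs by (auto simp: x_def inj_on_def nth_eq_iff_index_eq intro!: arg_cong[of _ _ z] inv_into_f_f)
  have zI: "z i = 0" if "i \<in> I" for i
  proof -
    have "i \<in> h ` {0..<card I}" using that bij_betw_imp_surj_on[OF h] by simp
    then obtain k where "k < card I" "i = h k" by auto
    then show ?thesis using y(2) by (simp add: z_def)
  qed
  have x0: "x v = 0" if "v \<in> V - S" for v
    using that vs xz zI by (auto simp: I_def in_set_conv_nth)
  have ker: "(\<Sum>c<n. A $$ (r, c) * z c) = 0" if r: "r < n" for r
  proof -
    have "(\<Sum>c<n. A $$ (r, c) * z c) = (\<Sum>c<n. \<Sum>j<N. A $$ (r, c) * w j $ c * y j)"
      by (simp add: z_def sum_distrib_left mult.assoc)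
    also have "\<dots> = (\<Sum>j<N. \<Sum>c<n. A $$ (r, c) * w j $ c * y j)" by (rule sum.swap)
    also have "\<dots> = (\<Sum>j<N. (A *\<^sub>v w j) $ r * y j)"
      using A r carrier_vecD[OF w(1)]
      by (intro sum.cong) (auto simp: scalar_prod_def lessThan_atLeast0 sum_distrib_right)
    also have "\<dots> = 0" using w(2) r by simp
    finally show ?thesis .
  qed
  have "x u = 0" if "u \<in> S" for u
  proof -
    have "(\<Sum>v\<in>S. weight \<Gamma> u v * x v) = 0" if u: "u \<in> S" for u
    proof -
      obtain r where r: "r < n" "u = vs ! r"
        using u S vs by (metis V_def in_set_conv_nth subsetD)
      have "(\<Sum>v\<in>S. weight \<Gamma> u v * x v) = (\<Sum>v\<in>V. weight \<Gamma> u v * x v)"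
        using S finV x0 by (intro sum.mono_neutral_left) (auto simp: V_def)
      also have "\<dots> = (\<Sum>c<n. weight \<Gamma> u (vs ! c) * x (vs ! c))"
        using sum_nth_enumeration[OF vs, of "\<lambda>v. weight \<Gamma> u v * x v"] by simp
      also have "\<dots> = (\<Sum>c<n. A $$ (r, c) * z c)"
        using r Aij xz by (intro sum.cong) auto
      finally show ?thesis using ker[OF r(1)] by simp
    qed
    then show ?thesis using ns that by (auto simp: nonsingular_on_def)
  qed
  then have z0: "z c = 0" if "c < n" for c
    using that xz x0 vs nth_mem[of c vs] by (metis DiffI)
  obtain i where i: "i < N" "y i \<noteq> 0" using y(1) by blast
  have "0 = (\<Sum>c<n. w i $ c * z c)" using z0 by simp
  also have "\<dots> = (\<Sum>c<n. \<Sum>j<N. w i $ c * w j $ c * y j)"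
    by (simp add: z_def sum_distrib_left mult.assoc)
  also have "\<dots> = (\<Sum>j<N. \<Sum>c<n. w i $ c * w j $ c * y j)" by (rule sum.swap)
  also have "\<dots> = (\<Sum>j<N. (w i \<bullet> w j) * y j)"
    using carrier_vecD[OF w(1)]
    by (intro sum.cong) (auto simp: scalar_prod_def lessThan_atLeast0 sum_distrib_right)
  also have "\<dots> = (\<Sum>j<N. if i = j then y j else 0)"
    using w(3) i by (intro sum.cong) auto
  also have "\<dots> = y i" using i by simp
  finally show False using i by simp
qed

lemma nullity_ge_of_factorization:
  assumes G: "signed_graph \<Gamma>" and L: "finite L"
    and fact: "\<And>u v. u \<in> verts (underlying \<Gamma>) \<Longrightarrow> v \<in> verts (underlying \<Gamma>) \<Longrightarrow>
      weight \<Gamma> u v = (\<Sum>l\<in>L. g l u * h l v)"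
  shows "graph_order \<Gamma> \<le> nullity \<Gamma> + card L"
proof -
  define n where "n = graph_order \<Gamma>"
  obtain vs A where vs: "distinct vs" "set vs = verts (underlying \<Gamma>)" "length vs = n"
    and A: "A \<in> carrier_mat n n"
    and Aij: "\<And>i j. i < n \<Longrightarrow> j < n \<Longrightarrow> A $$ (i, j) = weight \<Gamma> (vs ! i) (vs ! j)"
    and ord: "nullity \<Gamma> = order 0 (char_poly A)"
    using signed_graph_enumeration[OF G] unfolding n_def by metis
  obtain ls where ls: "distinct ls" "set ls = L" "length ls = card L"
    using L finite_distinct_list distinct_card by metis
  define C where "C = mat n (card L) (\<lambda>(i, j). g (ls ! j) (vs ! i))"
  define F where "F = mat (card L) n (\<lambda>(i, j). h (ls ! i) (vs ! j))"
  have CF: "C \<in> carrier_mat n (card L)" "F \<in> carrier_mat (card L) n"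
    by (auto simp: C_def F_def)
  have "A = C * F"
  proof (rule eq_matI)
    fix i j assume "i < dim_row (C * F)" "j < dim_col (C * F)"
    then have ij: "i < n" "j < n" using CF by auto
    have "A $$ (i, j) = (\<Sum>l\<in>L. g l (vs ! i) * h l (vs ! j))"
      using ij Aij fact vs by (metis nth_mem)
    also have "\<dots> = (\<Sum>k<card L. g (ls ! k) (vs ! i) * h (ls ! k) (vs ! j))"
      using sum_nth_enumeration[OF ls, of "\<lambda>l. g l (vs ! i) * h l (vs ! j)"] by simp
    also have "\<dots> = (C * F) $$ (i, j)"
      using ij by (simp add: C_def F_def scalar_prod_def lessThan_atLeast0)
    finally show "A $$ (i, j) = (C * F) $$ (i, j)" .
  qed (use A CF in auto)
  then show ?thesis using order_zero_ge_of_factorization[OF CF] ord by (simp add: n_def)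
qed

text \<open>Every nonzero entry lies in a row or in a column indexed by \<open>W\<close>. The index \<open>(w, True)\<close> contributes the row
  of \<open>w\<close>, and \<open>(w, False)\<close> the part of the column of \<open>w\<close> that the rows leave over.\<close>

lemma nullity_ge_of_vertex_cover:
  assumes G: "signed_graph \<Gamma>" and W: "finite W"
    and cover: "\<And>u v. {u, v} \<in> edges (underlying \<Gamma>) \<Longrightarrow> u \<in> W \<or> v \<in> W"
  shows "graph_order \<Gamma> \<le> nullity \<Gamma> + 2 * card W"
proof -
  define g where "g = (\<lambda>(w, b) u. if b then (if u = w then 1 else 0) else if u \<in> W then 0 else weight \<Gamma> u w)"
  define h where "h = (\<lambda>(w, b) v. if b then weight \<Gamma> w v else (if v = w then 1 else 0 :: real))"
  have "weight \<Gamma> u v = (\<Sum>l\<in>W \<times> UNIV. g l u * h l v)" for u v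
  proof -
    have "(\<Sum>l\<in>W \<times> UNIV. g l u * h l v)
        = (\<Sum>w\<in>W. (if u = w then weight \<Gamma> w v else 0) +
            (if v = w then (if u \<in> W then 0 else weight \<Gamma> u w) else 0))"
    proof -
      have "(\<Sum>l\<in>W \<times> UNIV. g l u * h l v) = (\<Sum>w\<in>W. \<Sum>b\<in>UNIV. g (w, b) u * h (w, b) v)"
        by (simp add: sum.cartesian_product case_prod_unfold)
      also have "\<dots> = (\<Sum>w\<in>W. g (w, True) u * h (w, True) v + g (w, False) u * h (w, False) v)"
        by (simp add: UNIV_bool add.commute)
      also have "\<dots> = (\<Sum>w\<in>W. (if u = w then weight \<Gamma> w v else 0) +
            (if v = w then (if u \<in> W then 0 else weight \<Gamma> u w) else 0))"
        by (intro sum.cong) (simp_all add: g_def h_def)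
      finally show ?thesis .
    qed
    also have "\<dots> = (if u \<in> W then weight \<Gamma> u v else 0) +
        (if v \<in> W then (if u \<in> W then 0 else weight \<Gamma> u v) else 0)"
      using W by (simp add: sum.distrib)
    also have "\<dots> = weight \<Gamma> u v"
      using cover[of u v] by (auto simp: weight_eq_0_iff)
    finally show ?thesis by simp
  qed
  from nullity_ge_of_factorization[OF G _ this] W show ?thesis
    by (simp add: card_cartesian_product mult.commute)
qed

text \<open>Changing the sign of one colour class turns \<open>A\<close> into \<open>- A\<close>, so the characteristic polynomial \<open>p\<close>
  satisfies \<open>p (- x) = (- 1) ^ n * p x\<close>. Comparing lowest terms gives the parity of the order at \<open>0\<close>.\<close>

lemma nullity_parity_of_bipartite:
  assumes G: "signed_graph \<Gamma>"
    and col: "\<And>u v. {u, v} \<in> edges (underlying \<Gamma>) \<Longrightarrow> c u \<noteq> (c v :: bool)"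
  shows "even (nullity \<Gamma>) \<longleftrightarrow> even (graph_order \<Gamma>)"
proof -
  define n where "n = graph_order \<Gamma>"
  obtain vs A where vs: "distinct vs" "set vs = verts (underlying \<Gamma>)" "length vs = n"
    and A: "A \<in> carrier_mat n n"
    and Aij: "\<And>i j. i < n \<Longrightarrow> j < n \<Longrightarrow> A $$ (i, j) = weight \<Gamma> (vs ! i) (vs ! j)"
    and ord: "nullity \<Gamma> = order 0 (char_poly A)"
    using signed_graph_enumeration[OF G] unfolding n_def by metis
  define e where "e i = (if c (vs ! i) then 1 else - 1 :: real)" for i
  define D where "D = mat n n (\<lambda>(i, j). if i = j then e i else 0)"
  have D: "D \<in> carrier_mat n n" by (simp add: D_def)
  have ee: "e i * e i = 1" for i by (simp add: e_def)
  have DM: "(D * M) $$ (i, j) = e i * M $$ (i, j)" if "i < n" "j < n" "M \<in> carrier_mat n n" for M i j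
    using that by (simp add: D_def scalar_prod_def if_distrib[of "\<lambda>x. x * _"] cong: if_cong)
  have MD: "(M * D) $$ (i, j) = M $$ (i, j) * e j" if "i < n" "j < n" "M \<in> carrier_mat n n" for M i j
    using that by (simp add: D_def scalar_prod_def if_distrib[of "\<lambda>x. _ * x"] cong: if_cong)
  have "D * D = 1\<^sub>m n"
    using D ee by (intro eq_matI) (auto simp: DM[OF _ _ D] simp del: index_mult_mat(1), auto simp: D_def)
  then have dD: "det D * det D = 1" using det_mult[OF D D] by simp
  have flip: "poly (char_poly A) (- x) = (- 1) ^ n * poly (char_poly A) x" for x
  proof -
    let ?M = "x \<cdot>\<^sub>m 1\<^sub>m n - A"
    have M: "?M \<in> carrier_mat n n" using A by (auto intro!: minus_carrier_mat)
    have DMc: "D * ?M \<in> carrier_mat n n" using D M by auto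
    have "- x \<cdot>\<^sub>m 1\<^sub>m n - A = (- 1) \<cdot>\<^sub>m (D * ?M * D)"
    proof (rule eq_matI)
      fix i j assume "i < dim_row ((- 1) \<cdot>\<^sub>m (D * ?M * D))" "j < dim_col ((- 1) \<cdot>\<^sub>m (D * ?M * D))"
      then have ij: "i < n" "j < n" using D by auto
      have "((- 1) \<cdot>\<^sub>m (D * ?M * D)) $$ (i, j) = - (e i * e j * ?M $$ (i, j))"
        using ij D by (simp add: MD[OF ij DMc] DM[OF ij M] del: index_mult_mat(1) index_minus_mat assoc_mult_mat)
      also have "\<dots> = (- x \<cdot>\<^sub>m 1\<^sub>m n - A) $$ (i, j)"
      proof (cases "i = j")
        case True
        have "A $$ (i, i) = 0" using ij Aij col[of "vs ! i" "vs ! i"] by (auto simp: weight_def)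
        then show ?thesis using True ij A ee[of j] by simp
      next
        case False
        have "A $$ (i, j) = 0 \<or> e i * e j = - 1"
          using ij Aij col[of "vs ! i" "vs ! j"] by (auto simp: weight_def e_def)
        then show ?thesis using False ij A by auto
      qed
      finally show "(- x \<cdot>\<^sub>m 1\<^sub>m n - A) $$ (i, j) = ((- 1) \<cdot>\<^sub>m (D * ?M * D)) $$ (i, j)" by simp
    qed (use A D in auto)
    moreover have "det (D * ?M * D) = det D * det D * det ?M"
      using det_mult[OF DMc D] det_mult[OF D M] by simp
    moreover have "dim_col (D * ?M * D) = n" using D by simp
    ultimately show ?thesis by (simp add: poly_char_poly_real[OF A] dD)
  qed
  define N where "N = nullity \<Gamma>"
  have nz: "char_poly A \<noteq> 0" using degree_monic_char_poly[OF A] by auto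
  obtain q where q: "char_poly A = [:0, 1:] ^ N * q" "\<not> [:0, 1:] dvd q"
    using order_decomp[OF nz, of 0] ord by (auto simp: N_def)
  have q0: "poly q 0 \<noteq> 0" using q(2) poly_eq_0_iff_dvd[of q 0] by simp
  have "poly ([:0, 1:] ^ N * (Polynomial.smult ((- 1) ^ N) (pcompose q [:0, - 1:])))
      = poly ([:0, 1:] ^ N * Polynomial.smult ((- 1) ^ n) q)"
  proof
    fix x
    show "poly ([:0, 1:] ^ N * (Polynomial.smult ((- 1) ^ N) (pcompose q [:0, - 1:]))) x
      = poly ([:0, 1:] ^ N * Polynomial.smult ((- 1) ^ n) q) x"
      using flip[of x] by (simp add: q(1) poly_pcompose power_minus[of x] algebra_simps)
  qed
  then have "[:0, 1:] ^ N * (Polynomial.smult ((- 1) ^ N) (pcompose q [:0, - 1:])) = [:0, 1:] ^ N * Polynomial.smult ((- 1) ^ n) q"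
    by (simp only: poly_eq_poly_eq_iff)
  then have "Polynomial.smult ((- 1) ^ N) (pcompose q [:0, - 1:]) = Polynomial.smult ((- 1) ^ n) q"
    by (subst (asm) mult_left_cancel) simp_all
  then have "poly (Polynomial.smult ((- 1) ^ N) (pcompose q [:0, - 1:])) 0 = poly (Polynomial.smult ((- 1) ^ n) q) 0" by simp
  then have "(- 1 :: real) ^ N = (- 1) ^ n" using q0 by (simp add: poly_pcompose)
  then show ?thesis
    by (auto simp: N_def n_def minus_one_power_iff split: if_splits)
qed

lemma nonsingular_on_empty: "nonsingular_on \<Gamma> {}"
  by (simp add: nonsingular_on_def)

text \<open>The row of \<open>p\<close> forces \<open>x q = 0\<close>, the rows of \<open>S\<close> then force \<open>x = 0\<close> on \<open>S\<close>, and finally the row of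
  \<open>q\<close> forces \<open>x p = 0\<close>.\<close>

lemma nonsingular_on_pendant:
  assumes fin: "finite S" and ns: "nonsingular_on \<Gamma> S" and out: "p \<notin> S" "q \<notin> S" "p \<noteq> q"
    and simple: "{p} \<notin> edges (underlying \<Gamma>)"
    and pq: "{p, q} \<in> edges (underlying \<Gamma>)"
    and pend: "\<And>v. v \<in> S \<Longrightarrow> {p, v} \<notin> edges (underlying \<Gamma>)"
  shows "nonsingular_on \<Gamma> (insert p (insert q S))"
  unfolding nonsingular_on_def
proof (intro allI impI)
  fix x
  assume eqs: "\<forall>u\<in>insert p (insert q S). (\<Sum>v\<in>insert p (insert q S). weight \<Gamma> u v * x v) = 0"
  have row: "weight \<Gamma> u p * x p + (weight \<Gamma> u q * x q + (\<Sum>v\<in>S. weight \<Gamma> u v * x v)) = 0"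
    if "u \<in> insert p (insert q S)" for u
  proof -
    have "(\<Sum>v\<in>insert p (insert q S). weight \<Gamma> u v * x v) = 0" using eqs that by blast
    then show ?thesis using fin out by simp
  qed
  have wp: "weight \<Gamma> p v = 0" "weight \<Gamma> v p = 0" if "v \<in> insert p S" for v
    using pend[of v] simple that weight_commute[of \<Gamma> v p] by (auto simp: weight_eq_0_iff)
  have wpq: "weight \<Gamma> p q \<noteq> 0" "weight \<Gamma> q p \<noteq> 0"
    using pq by (auto simp: weight_eq_0_iff insert_commute)
  have xq: "x q = 0" using row[of p] wp wpq by simp
  have xS: "x u = 0" if "u \<in> S" for u
  proof -
    have "\<forall>u\<in>S. (\<Sum>v\<in>S. weight \<Gamma> u v * x v) = 0"
      using row wp xq by force
    then show ?thesis using ns that unfolding nonsingular_on_def by blast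
  qed
  have "x p = 0" using row[of q] xq xS wpq by simp
  then show "\<forall>u\<in>insert p (insert q S). x u = 0" using xq xS by auto
qed

section \<open>Cycles, graph isomorphisms and two-colourings\<close>

lemma edge_in_verts:
  assumes "simple_graph G" "{u, v} \<in> edges G"
  shows "u \<in> verts G" "v \<in> verts G" "u \<noteq> v"
proof -
  obtain a b where "a \<in> verts G" "b \<in> verts G" "a \<noteq> b" "{u, v} = {a, b}"
    using assms unfolding simple_graph_def by blast
  then show "u \<in> verts G" "v \<in> verts G" "u \<noteq> v" by (auto simp: doubleton_eq_iff)
qed

text \<open>Only on simple graphs do edges consist of two vertices, so that preserving adjacency amounts to mapping
  one edge set onto the other. This form makes it easy to transport explicit lists of edges.\<close>

lemma graph_iso_iff_edges_image:
  assumes G: "simple_graph G" and H: "simple_graph H"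
  shows "graph_iso G H \<longleftrightarrow>
    (\<exists>h. bij_betw h (verts H) (verts G) \<and> edges G = (\<lambda>e. h ` e) ` edges H)"
proof
  assume "graph_iso G H"
  then obtain f where f: "bij_betw f (verts G) (verts H)"
    and fe: "\<And>u v. u \<in> verts G \<Longrightarrow> v \<in> verts G \<Longrightarrow> {u, v} \<in> edges G \<longleftrightarrow> {f u, f v} \<in> edges H"
    unfolding graph_iso_def by blast
  define h where "h = inv_into (verts G) f"
  have h: "bij_betw h (verts H) (verts G)" unfolding h_def by (rule bij_betw_inv_into[OF f])
  have fh: "f (h y) = y" if "y \<in> verts H" for y
    unfolding h_def by (rule bij_betw_inv_into_right[OF f that])
  have hf: "h (f x) = x" if "x \<in> verts G" for x
    unfolding h_def by (rule bij_betw_inv_into_left[OF f that])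
  have "edges G = (\<lambda>e. h ` e) ` edges H"
  proof (intro equalityI subsetI)
    fix e assume e: "e \<in> edges G"
    then obtain u v where uv: "u \<in> verts G" "v \<in> verts G" "e = {u, v}"
      using G unfolding simple_graph_def by blast
    then have "{f u, f v} \<in> edges H" using e fe by blast
    moreover have "h ` {f u, f v} = e" using uv hf by simp
    ultimately show "e \<in> (\<lambda>e. h ` e) ` edges H" by (metis image_eqI)
  next
    fix e assume "e \<in> (\<lambda>e. h ` e) ` edges H"
    then obtain e' where e': "e' \<in> edges H" "e = h ` e'" by blast
    then obtain u v where uv: "u \<in> verts H" "v \<in> verts H" "e' = {u, v}"
      using H unfolding simple_graph_def by blast
    then have "{f (h u), f (h v)} \<in> edges H" using e' fh by simp
    then have "{h u, h v} \<in> edges G" using fe uv bij_betwE[OF h] by blast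
    then show "e \<in> edges G" using e' uv by simp
  qed
  with h show "\<exists>h. bij_betw h (verts H) (verts G) \<and> edges G = (\<lambda>e. h ` e) ` edges H" by blast
next
  assume "\<exists>h. bij_betw h (verts H) (verts G) \<and> edges G = (\<lambda>e. h ` e) ` edges H"
  then obtain h where h: "bij_betw h (verts H) (verts G)" and E: "edges G = (\<lambda>e. h ` e) ` edges H"
    by blast
  define f where "f = inv_into (verts H) h"
  have f: "bij_betw f (verts G) (verts H)" unfolding f_def by (rule bij_betw_inv_into[OF h])
  have hf: "h (f x) = x" if "x \<in> verts G" for x
    unfolding f_def by (rule bij_betw_inv_into_right[OF h that])
  have fh: "f (h y) = y" if "y \<in> verts H" for y
    unfolding f_def by (rule bij_betw_inv_into_left[OF h that])
  have "{u, v} \<in> edges G \<longleftrightarrow> {f u, f v} \<in> edges H" if uv: "u \<in> verts G" "v \<in> verts G" for u v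
  proof
    assume "{u, v} \<in> edges G"
    then obtain e where e: "e \<in> edges H" "{u, v} = h ` e" using E by blast
    obtain p q where pq: "p \<in> verts H" "q \<in> verts H" "e = {p, q}"
      using H e(1) unfolding simple_graph_def by metis
    then have "f ` {u, v} = e" unfolding e(2) by (simp add: fh)
    then show "{f u, f v} \<in> edges H" using e(1) by simp
  next
    assume "{f u, f v} \<in> edges H"
    then have "h ` {f u, f v} \<in> edges G" using E by blast
    then show "{u, v} \<in> edges G" using uv hf by simp
  qed
  then show "graph_iso G H" unfolding graph_iso_def using f by blast
qed

text \<open>Cycles are periodic sequences of vertices: indices may exceed the length, so that shifting the starting
  point needs no arithmetic modulo \<open>k\<close>.\<close>

definition cycle_in :: "'a ugraph \<Rightarrow> nat \<Rightarrow> (nat \<Rightarrow> 'a) \<Rightarrow> bool" where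
  "cycle_in G k f \<longleftrightarrow> 3 \<le> k \<and> (\<forall>i j. f i = f j \<longleftrightarrow> i mod k = j mod k) \<and>
     (\<forall>i. {f i, f (Suc i)} \<in> edges G)"

lemma range_eq_image_period:
  assumes "\<And>i. f (i mod k) = f i" "0 < (k :: nat)"
  shows "range f = f ` {0..<k}"
proof -
  have "f i \<in> f ` {0..<k}" for i
    using assms by (intro image_eqI[of _ _ "i mod k"]) simp_all
  then show ?thesis by auto
qed

lemma cycle_in_period:
  assumes "cycle_in G k f"
  shows "f (i mod k) = f i" "f (i + k) = f i"
  using assms by (auto simp: cycle_in_def)

lemma cycle_in_range:
  assumes "cycle_in G k f"
  shows "range f = f ` {0..<k}" "card (range f) = k"
proof -
  show *: "range f = f ` {0..<k}"
    using assms cycle_in_period[OF assms] by (intro range_eq_image_period) (auto simp: cycle_in_def)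
  have "inj_on f {0..<k}" using assms by (auto simp: inj_on_def cycle_in_def)
  then show "card (range f) = k" by (simp add: * card_image)
qed

lemma simple_cycle_graph:
  assumes "3 \<le> m" shows "simple_graph (cycle_graph m)"
proof -
  have "\<exists>u\<in>{0..<m}. \<exists>v\<in>{0..<m}. u \<noteq> v \<and> {i, Suc i mod m} = {u, v}" if "i < m" for i
    using assms that by (intro bexI[of _ i] bexI[of _ "Suc i mod m"]) (auto simp: mod_Suc)
  then show ?thesis unfolding simple_graph_def cycle_graph_def by auto
qed

lemma graph_iso_cycle_graph_iff:
  assumes G: "simple_graph G" and m: "3 \<le> m"
  shows "graph_iso G (cycle_graph m) \<longleftrightarrow>
    (\<exists>f. cycle_in G m f \<and> verts G = range f \<and> edges G = range (\<lambda>i. {f i, f (Suc i)}))"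
proof -
  have E: "(\<lambda>e. h ` e) ` edges (cycle_graph m) = range (\<lambda>i. {f i, f (Suc i)})"
    if "\<And>i. f i = h (i mod m)" for f h :: "nat \<Rightarrow> 'a"
  proof -
    have "range (\<lambda>i. {f i, f (Suc i)}) = (\<lambda>i. {f i, f (Suc i)}) ` {0..<m}"
      using m that by (intro range_eq_image_period) (auto simp: mod_Suc_eq)
    also have "\<dots> = (\<lambda>i. h ` {i, Suc i mod m}) ` {0..<m}"
      using that by (intro image_cong) auto
    also have "\<dots> = (\<lambda>e. h ` e) ` edges (cycle_graph m)"
      by (simp add: cycle_graph_def setcompr_eq_image image_image atLeast0LessThan lessThan_def)
    finally show ?thesis by simp
  qed
  show ?thesis
  proof
    assume "graph_iso G (cycle_graph m)"
    then obtain h where h: "bij_betw h {0..<m} (verts G)"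
      and Eh: "edges G = (\<lambda>e. h ` e) ` edges (cycle_graph m)"
      using graph_iso_iff_edges_image[OF G simple_cycle_graph[OF m]] by (auto simp: cycle_graph_def)
    define f where "f i = h (i mod m)" for i
    have EG: "edges G = range (\<lambda>i. {f i, f (Suc i)})" using E[of f h] Eh f_def by simp
    have "range f = f ` {0..<m}" using m by (intro range_eq_image_period) (auto simp: f_def)
    also have "\<dots> = h ` {0..<m}" by (intro image_cong) (auto simp: f_def)
    also have "\<dots> = verts G" using h by (rule bij_betw_imp_surj_on)
    finally have "verts G = range f" by simp
    moreover have "f i = f j \<longleftrightarrow> i mod m = j mod m" for i j
      using m inj_onD[OF bij_betw_imp_inj_on[OF h], of "i mod m" "j mod m"] by (auto simp: f_def)
    ultimately show "\<exists>f. cycle_in G m f \<and> verts G = range f \<and> edges G = range (\<lambda>i. {f i, f (Suc i)})"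
      using m EG unfolding cycle_in_def by (intro exI[of _ f]) auto
  next
    assume "\<exists>f. cycle_in G m f \<and> verts G = range f \<and> edges G = range (\<lambda>i. {f i, f (Suc i)})"
    then obtain f where f: "cycle_in G m f" "verts G = range f" "edges G = range (\<lambda>i. {f i, f (Suc i)})"
      by blast
    have "bij_betw f {0..<m} (verts G)"
      using f(1,2) cycle_in_range(1)[OF f(1)] by (auto simp: bij_betw_def inj_on_def cycle_in_def)
    moreover have "edges G = (\<lambda>e. f ` e) ` edges (cycle_graph m)"
      using E[of f f] cycle_in_period(1)[OF f(1)] f(3) by simp
    ultimately show "graph_iso G (cycle_graph m)"
      using graph_iso_iff_edges_image[OF G simple_cycle_graph[OF m]] by (auto simp: cycle_graph_def)
  qed
qed

lemma cycle_in_of_list: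
  assumes "distinct xs" "3 \<le> length xs" "successively (\<lambda>u v. {u, v} \<in> edges G) xs"
    "{last xs, hd xs} \<in> edges G"
  shows "cycle_in G (length xs) (\<lambda>i. xs ! (i mod length xs))"
    and "range (\<lambda>i. xs ! (i mod length xs)) = set xs"
proof -
  let ?k = "length xs"
  have k: "0 < ?k" using assms(2) by linarith
  have "{xs ! (i mod ?k), xs ! (Suc i mod ?k)} \<in> edges G" for i
  proof (cases "Suc (i mod ?k) = ?k")
    case True
    then have "i mod ?k = ?k - 1" "Suc i mod ?k = 0" by (auto simp: mod_Suc)
    then show ?thesis using assms(4) k by (simp add: last_conv_nth hd_conv_nth)
  next
    case False
    then have "Suc (i mod ?k) < ?k" using k mod_less_divisor[of ?k i] by linarith
    then show ?thesis using assms(3) False by (simp add: successively_conv_nth mod_Suc)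
  qed
  then show "cycle_in G (length xs) (\<lambda>i. xs ! (i mod length xs))"
    using assms(1,2) k by (auto simp: cycle_in_def nth_eq_iff_index_eq)
  show "range (\<lambda>i. xs ! (i mod length xs)) = set xs"
    using k by (subst range_eq_image_period[of _ ?k]) (auto simp: set_conv_nth)
qed

abbreviation adj_rel :: "'a ugraph \<Rightarrow> ('a \<times> 'a) set" where
  "adj_rel G \<equiv> {(u, v). {u, v} \<in> edges G}"

text \<open>A closed walk that revisits a vertex splits there into two shorter closed walks, one of which has odd
  length.\<close>

lemma odd_closed_walk_imp_odd_cycle:
  assumes "simple_graph G" "(v, v) \<in> adj_rel G ^^ m" "odd m"
  shows "\<exists>l g. odd l \<and> cycle_in G l g"
  using assms(2,3)
proof (induction m arbitrary: v rule: less_induct)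
  case (less m)
  obtain f where f: "f 0 = v" "f m = v" "\<And>i. i < m \<Longrightarrow> {f i, f (Suc i)} \<in> edges G"
    using less.prems(1) by (auto simp: relpow_fun_conv)
  have sub: "(f i, f j) \<in> adj_rel G ^^ (j - i)" if "i \<le> j" "j \<le> m" for i j
    using that f(3) by (auto simp: relpow_fun_conv intro!: exI[of _ "\<lambda>l. f (i + l)"])
  show ?case
  proof (cases "inj_on f {..<m}")
    case True
    \<comment> \<open>A closed walk of length one would be a loop.\<close>
    have "m \<noteq> 1" using f edge_in_verts(3)[OF assms(1)] by fastforce
    then have m: "3 \<le> m" using less.prems(2) by (cases m; cases "m - 1") (auto elim!: oddE)
    have "{f (i mod m), f (Suc i mod m)} \<in> edges G" for i
    proof -
      have "i mod m < m" using m by simp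
      then show ?thesis using f(1,2) f(3)[of "i mod m"] by (auto simp: mod_Suc)
    qed
    moreover have "f (i mod m) = f (j mod m) \<longleftrightarrow> i mod m = j mod m" for i j
      using inj_onD[OF True, of "i mod m" "j mod m"] m by auto
    ultimately have "cycle_in G m (\<lambda>i. f (i mod m))" using m by (auto simp: cycle_in_def)
    then show ?thesis using less.prems(2) by blast
  next
    case False
    then obtain i j where ij: "i < j" "j < m" "f i = f j"
      unfolding inj_on_def by (metis lessThan_iff linorder_neqE_nat)
    show ?thesis
    proof (cases "odd (j - i)")
      case True
      then show ?thesis using less.IH[of "j - i" "f i"] sub[of i j] ij by auto
    next
      case False
      have "(v, v) \<in> adj_rel G ^^ (i + (m - j))"
        using sub[of 0 i] sub[of j m] ij f(1,2) unfolding relpow_add by auto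
      moreover have "odd (i + (m - j))" using False less.prems(2) ij by auto
      ultimately show ?thesis using less.IH[of "i + (m - j)" v] ij by auto
    qed
  qed
qed

text \<open>Vertices are coloured by the parity of walks from a root. An edge inside a colour class would close
  an odd walk through the root.\<close>

lemma two_colouring_of_no_odd_cycle:
  assumes G: "simple_graph G" and conn: "connected_graph G"
    and no_odd: "\<And>l g. cycle_in G l g \<Longrightarrow> even l"
  shows "\<exists>c. \<forall>u v. {u, v} \<in> edges G \<longrightarrow> c u \<noteq> (c v :: bool)"
proof -
  let ?R = "adj_rel G"
  obtain r where r: "r \<in> verts G" using conn by (auto simp: connected_graph_def)
  define c where "c v \<longleftrightarrow> (\<exists>m. even m \<and> (r, v) \<in> ?R ^^ m)" for v
  have walk: "\<exists>m. (r, v) \<in> ?R ^^ m \<and> (even m \<longleftrightarrow> c v)" if "v \<in> verts G" for v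
  proof -
    have "(r, v) \<in> ?R\<^sup>*" using conn r that by (auto simp: connected_graph_def)
    then obtain m where "(r, v) \<in> ?R ^^ m" using rtrancl_imp_relpow by blast
    then show ?thesis unfolding c_def by blast
  qed
  have sym: "(v, u) \<in> ?R ^^ m" if walk: "(u, v) \<in> ?R ^^ m" for u v m
  proof -
    obtain f where f: "f 0 = u" "f m = v" "\<And>i. i < m \<Longrightarrow> {f i, f (Suc i)} \<in> edges G"
      using walk by (auto simp: relpow_fun_conv)
    have "{f (m - i), f (m - Suc i)} \<in> edges G" if "i < m" for i
      using f(3)[of "m - Suc i"] that by (simp add: Suc_diff_Suc insert_commute)
    then show ?thesis using f by (auto simp: relpow_fun_conv intro!: exI[of _ "\<lambda>i. f (m - i)"])
  qed
  have "c u \<noteq> c v" if uv: "{u, v} \<in> edges G" for u v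
  proof
    assume same: "c u = c v"
    obtain a b where ab: "(r, u) \<in> ?R ^^ a" "(r, v) \<in> ?R ^^ b" "even a \<longleftrightarrow> even b"
      using walk same edge_in_verts[OF G uv] by metis
    have "(r, v) \<in> ?R ^^ Suc a" using ab(1) uv by auto
    then have "(r, r) \<in> ?R ^^ (Suc a + b)"
      using sym[OF ab(2)] unfolding relpow_add by blast
    moreover have "odd (Suc a + b)" using ab(3) by simp
    ultimately show False using odd_closed_walk_imp_odd_cycle[OF G] no_odd by blast
  qed
  then show ?thesis by blast
qed

section \<open>Unicyclic signed graphs\<close>

lemma prod_lessThan_add:
  "(\<Prod>l<m + n. g l) = (\<Prod>l<m. g l) * (\<Prod>l<n. g (m + l :: nat) :: real)"
  by (induction n) (simp_all add: mult.assoc)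

lemma sum_eq_two:
  assumes "finite T" "a \<in> T" "b \<in> T" "a \<noteq> b" "\<And>v. v \<in> T \<Longrightarrow> v \<noteq> a \<Longrightarrow> v \<noteq> b \<Longrightarrow> g v = 0"
  shows "sum g T = g a + (g b :: real)"
proof -
  have "sum g T = sum g {a, b}" using assms by (intro sum.mono_neutral_right) auto
  then show ?thesis using assms(4) by simp
qed

text \<open>The shape of \<open>U4\<close>: the triangle \<open>a b c\<close>, the edge from \<open>a\<close> to the centre \<open>d\<close> of the star, and the
  remaining leaves \<open>L\<close> of that star.\<close>

definition U4_shaped :: "'a ugraph \<Rightarrow> 'a \<Rightarrow> 'a \<Rightarrow> 'a \<Rightarrow> 'a \<Rightarrow> 'a set \<Rightarrow> bool" where
  "U4_shaped G a b c d L \<longleftrightarrow> distinct [a, b, c, d] \<and> finite L \<and> L \<noteq> {} \<and> L \<inter> {a, b, c, d} = {} \<and>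
     verts G = {a, b, c, d} \<union> L \<and>
     edges G = {{a, b}, {b, c}, {a, c}, {a, d}} \<union> (\<lambda>y. {d, y}) ` L"

text \<open>Every forbidden edge below would produce a cycle on another vertex set, so uniqueness of the cycle is
  stated for vertex sets; the sequence \<open>f\<close> fixes a starting point and a direction on the cycle.\<close>

locale unicyclic_signed_graph =
  fixes \<Gamma> :: "'a signed_graph" and k :: nat and f :: "nat \<Rightarrow> 'a"
  assumes simple: "simple_graph (underlying \<Gamma>)"
    and connected: "connected_graph (underlying \<Gamma>)"
    and cycle: "cycle_in (underlying \<Gamma>) k f"
    and unique: "cycle_in (underlying \<Gamma>) l g \<Longrightarrow> range g = range f"
begin

abbreviation "V \<equiv> verts (underlying \<Gamma>)"
abbreviation "T \<equiv> range f"
abbreviation adj where "adj u v \<equiv> {u, v} \<in> edges (underlying \<Gamma>)"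

lemma signed: "signed_graph \<Gamma>" using simple by (simp add: signed_graph_def)
lemma finite_V: "finite V" using simple by (simp add: simple_graph_def)
lemma order_eq: "graph_order \<Gamma> = card V" by (simp add: graph_order_def)
lemma adj_sym: "adj u v \<Longrightarrow> adj v u" by (simp add: insert_commute)
lemma adj_V: "adj u v \<Longrightarrow> u \<in> V" "adj u v \<Longrightarrow> v \<in> V" using edge_in_verts[OF simple] by blast+
lemma adj_irrefl: "\<not> adj u u" using edge_in_verts(3)[OF simple] by blast
lemma k3: "3 \<le> k" using cycle by (simp add: cycle_in_def)
lemma f_eq_iff: "f i = f j \<longleftrightarrow> i mod k = j mod k" using cycle by (simp add: cycle_in_def)
lemma adj_f: "adj (f i) (f (Suc i))" using cycle by (simp add: cycle_in_def)
lemma f_period: "f (i + k) = f i" by (rule cycle_in_period[OF cycle])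
lemma f_neq:
  assumes "i < j" "j < i + k" shows "f i \<noteq> f j"
proof
  assume "f i = f j"
  then have "k dvd j - i" using assms(1) mod_eq_dvd_iff_nat[of i j k] by (simp add: f_eq_iff)
  then show False using assms nat_dvd_not_less[of "j - i" k] by simp
qed

lemma card_T: "card T = k" by (rule cycle_in_range[OF cycle])
lemma T_V: "T \<subseteq> V" using adj_V adj_f by blast
lemma finite_T: "finite T" using T_V finite_V finite_subset by blast

text \<open>The source of all adjacency restrictions: a closed list of distinct vertices can only run through \<open>T\<close>.\<close>

lemma cycle_list:
  assumes "distinct xs" "3 \<le> length xs" "successively adj xs" "adj (last xs) (hd xs)"
  shows "set xs = T" "length xs = k"
proof -
  show "set xs = T" using cycle_in_of_list[OF assms] unique by blast
  then show "length xs = k" using assms(1) card_T distinct_card by metis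
qed

lemma from_offset:
  assumes "t \<in> T" obtains d where "d < k" "t = f (i + d)"
proof -
  obtain j where j: "t = f j" using assms by blast
  let ?d = "(j + (k - 1) * i) mod k"
  \<comment> \<open>The offset \<open>d\<close> is \<open>j - i\<close> modulo \<open>k\<close>, written without subtraction.\<close>
  have "(i + ?d) mod k = (i + (j + (k - 1) * i)) mod k" by (simp add: mod_add_right_eq)
  also have "i + (j + (k - 1) * i) = j + k * i" using k3 by (cases k) auto
  finally have "f (i + ?d) = f j" by (simp add: f_eq_iff)
  then show ?thesis using that[of ?d] k3 j by simp
qed

lemma arc:
  assumes "i \<le> j" "j < i + k"
  shows "distinct (map f [i..<Suc j])" "successively adj (map f [i..<Suc j])"
    "length (map f [i..<Suc j]) = Suc j - i"
    "hd (map f [i..<Suc j]) = f i" "last (map f [i..<Suc j]) = f j"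
proof -
  show "length (map f [i..<Suc j]) = Suc j - i" by (simp del: upt_Suc)
  show "hd (map f [i..<Suc j]) = f i" using assms(1) by (simp add: hd_map del: upt_Suc)
  show "last (map f [i..<Suc j]) = f j" using assms(1) by simp
  have "f p \<noteq> f q" if "p < q" "i \<le> p" "q \<le> j" for p q using f_neq[of p q] that assms by linarith
  then show "distinct (map f [i..<Suc j])"
    by (auto simp: distinct_map inj_on_def simp del: upt_Suc) (metis less_Suc_eq_le linorder_neqE_nat)
  show "successively adj (map f [i..<Suc j])"
    using adj_f by (auto simp: successively_conv_nth simp del: upt_Suc)
qed

text \<open>A chord would close up a proper arc of the cycle.\<close>

lemma chordless:
  assumes "i < j" "Suc i \<noteq> j" "Suc j < i + k"
  shows "\<not> adj (f i) (f j)"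
proof
  assume a: "adj (f i) (f j)"
  have "length (map f [i..<Suc j]) = k"
  proof (rule cycle_list(2))
    show "adj (last (map f [i..<Suc j])) (hd (map f [i..<Suc j]))"
      using assms arc(4,5)[of i j] adj_sym[OF a] by simp
  qed (use assms arc[of i j] in simp_all)
  then show False using assms by simp
qed

text \<open>Otherwise \<open>x\<close> together with an arc between its two neighbours would form a second cycle.\<close>

lemma attached_once:
  assumes x: "x \<notin> T" and adj: "adj x s" "adj x t" and st: "s \<in> T" "t \<in> T"
  shows "t = s"
proof (rule ccontr)
  assume "t \<noteq> s"
  obtain i where i: "s = f i" using st(1) by blast
  obtain d where d: "d < k" "t = f (i + d)" using from_offset[OF st(2)] by metis
  then have d0: "0 < d" using \<open>t \<noteq> s\<close> i by (cases d) auto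
  let ?xs = "map f [i..<Suc (i + d)]"
  have "set (x # ?xs) = T"
  proof (rule cycle_list(1))
    note arc = arc[of i "i + d", OF le_add1 nat_add_left_cancel_less[THEN iffD2, OF d(1)]]
    have "?xs \<noteq> []" by simp
    then show "successively adj (x # ?xs)" "adj (last (x # ?xs)) (hd (x # ?xs))"
      using arc(2,4,5) adj adj_sym d(2) i unfolding successively_Cons by (simp_all del: upt_Suc)
    show "distinct (x # ?xs)" using arc(1) x by (auto simp del: upt_Suc)
    show "3 \<le> length (x # ?xs)" using d0 by simp
  qed
  then show False using x by auto
qed

text \<open>A kernel vector on the cycle is determined along steps of length two by
  \<open>y (j + 2) = - s j * s (j + 1) * y j\<close>. After \<open>k\<close> such steps the cycle has been traversed twice, each sign
  has occurred twice, and \<open>y\<close> has been multiplied by \<open>(- 1) ^ k = - 1\<close>.\<close>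

lemma nonsingular_on_odd_cycle:
  assumes "odd k"
  shows "nonsingular_on \<Gamma> T"
  unfolding nonsingular_on_def
proof (intro allI impI ballI)
  fix x u
  assume eq: "\<forall>u\<in>T. (\<Sum>v\<in>T. weight \<Gamma> u v * x v) = 0" and "u \<in> T"
  then obtain i where u: "u = f i" by blast
  define s where "s j = weight \<Gamma> (f j) (f (Suc j))" for j
  define y where "y j = x (f j)" for j
  have ss: "s j * s j = 1" for j unfolding s_def by (rule weight_square[OF adj_f])
  have row: "s j * y j + s (Suc j) * y (Suc (Suc j)) = 0" for j
  proof -
    have "weight \<Gamma> (f (Suc j)) v * x v = 0" if v: "v \<in> T" "v \<noteq> f j" "v \<noteq> f (Suc (Suc j))" for v
    proof -
      obtain d where d: "d < k" "v = f (Suc j + d)" using from_offset[OF v(1)] by metis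
      have "d \<noteq> 1" using d v by auto
      moreover have "Suc d \<noteq> k"
      proof
        assume "Suc d = k"
        then have "v = f (j + k)" using d by auto
        then show False using v f_period by simp
      qed
      ultimately have "\<not> adj (f (Suc j)) v"
        using chordless[of "Suc j" "Suc j + d"] d adj_irrefl by (cases "d = 0") auto
      then show ?thesis by (simp add: weight_eq_0_iff)
    qed
    moreover have "f j \<noteq> f (Suc (Suc j))" using f_neq[of j "Suc (Suc j)"] k3 by simp
    ultimately have "(\<Sum>v\<in>T. weight \<Gamma> (f (Suc j)) v * x v)
        = weight \<Gamma> (f (Suc j)) (f j) * x (f j) + weight \<Gamma> (f (Suc j)) (f (Suc (Suc j))) * x (f (Suc (Suc j)))"
      by (intro sum_eq_two finite_T) auto
    then show ?thesis using eq by (simp add: s_def y_def weight_commute)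
  qed
  have step: "y (Suc (Suc j)) = - (s j * s (Suc j)) * y j" for j
  proof -
    have "s (Suc j) * (s j * y j + s (Suc j) * y (Suc (Suc j))) = 0" using row by simp
    then have "s (Suc j) * s j * y j + (s (Suc j) * s (Suc j)) * y (Suc (Suc j)) = 0"
      by (simp add: algebra_simps)
    then show ?thesis by (simp add: ss mult.commute)
  qed
  have iter: "y (i + 2 * m) = (- 1) ^ m * (\<Prod>l<2 * m. s (i + l)) * y i" for m
    by (induction m) (simp_all add: step)
  have "(\<Prod>l<2 * k. s (i + l)) = (\<Prod>l<k. s (i + l)) * (\<Prod>l<k. s (i + (k + l)))"
    using prod_lessThan_add[of "\<lambda>l. s (i + l)" k k] by (simp add: mult_2)
  also have "\<dots> = (\<Prod>l<k. s (i + l) * s (i + l))"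
  proof -
    have "s (i + (k + l)) = s (i + l)" for l
      using f_period[of "i + l"] f_period[of "Suc (i + l)"] by (simp add: s_def add_ac)
    then show ?thesis by (simp add: prod.distrib)
  qed
  also have "\<dots> = 1" by (simp add: ss)
  finally have "y (i + 2 * k) = - y i" using iter[of k] assms by simp
  moreover have "y (i + 2 * k) = y i"
    using f_period[of i] f_period[of "i + k"] by (simp add: y_def mult_2 add_ac)
  ultimately show "x u = 0" by (simp add: y_def u)
qed

lemma nullity_parity_of_even_cycle:
  assumes "even k"
  shows "even (nullity \<Gamma>) \<longleftrightarrow> even (graph_order \<Gamma>)"
proof -
  have "even l" if "cycle_in (underlying \<Gamma>) l g" for l g
    using unique[OF that] cycle_in_range(2)[OF that] card_T assms by simp
  then obtain c where "\<And>u v. adj u v \<Longrightarrow> c u \<noteq> (c v :: bool)"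
    using two_colouring_of_no_odd_cycle[OF simple connected] by metis
  then show ?thesis by (rule nullity_parity_of_bipartite[OF signed])
qed

text \<open>The six vertices induce a subgraph from which \<open>p1 q1\<close>, \<open>p2 q2\<close>, \<open>p3 q3\<close> can be removed one after the
  other as pendant edges; a \<open>q\<close> may be adjacent to vertices of later pairs.\<close>

lemma nullity_le_of_pendant_triple:
  assumes dist: "distinct [p1, q1, p2, q2, p3, q3]"
    and adj: "adj p1 q1" "adj p2 q2" "adj p3 q3"
    and nadj: "\<not> adj p1 p2" "\<not> adj p1 q2" "\<not> adj p1 p3" "\<not> adj p1 q3"
      "\<not> adj p2 p3" "\<not> adj p2 q3"
  shows "nullity \<Gamma> + 6 \<le> graph_order \<Gamma>"
proof -
  have "nonsingular_on \<Gamma> {p3, q3}"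
    using nonsingular_on_pendant[OF _ nonsingular_on_empty, of p3 q3] dist adj adj_irrefl[of p3] by simp
  then have "nonsingular_on \<Gamma> {p2, q2, p3, q3}"
    using nonsingular_on_pendant[of "{p3, q3}" \<Gamma> p2 q2] dist adj adj_irrefl[of p2] nadj by auto
  then have "nonsingular_on \<Gamma> {p1, q1, p2, q2, p3, q3}"
    using nonsingular_on_pendant[of "{p2, q2, p3, q3}" \<Gamma> p1 q1] dist adj adj_irrefl[of p1] nadj by auto
  moreover have "{p1, q1, p2, q2, p3, q3} \<subseteq> V" using adj adj_V by blast
  ultimately have "nullity \<Gamma> + card {p1, q1, p2, q2, p3, q3} \<le> graph_order \<Gamma>"
    by (intro nullity_le_of_nonsingular_on[OF signed])
  then show ?thesis using dist by simp
qed

lemma nullity_of_long_cycle: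
  assumes "7 \<le> k"
  shows "nullity \<Gamma> + 6 \<le> graph_order \<Gamma>"
proof (rule nullity_le_of_pendant_triple)
  have "distinct (map f [0..<Suc 5])" using arc(1)[of 0 5] assms by simp
  moreover have "[0..<Suc 5] = [0, 1, 2, 3, 4, 5]" by (simp add: upt_rec)
  ultimately show "distinct [f 0, f 1, f 2, f 3, f 4, f 5]" by simp
  show "adj (f 0) (f 1)" "adj (f 2) (f 3)" "adj (f 4) (f 5)"
    using adj_f[of 0] adj_f[of 2] adj_f[of 4] by simp_all
qed (rule chordless; use assms in simp)+

lemma exists_boundary_edge:
  assumes "S \<subseteq> V" "S \<noteq> {}" "S \<noteq> V"
  obtains u v where "u \<in> S" "v \<in> V" "v \<notin> S" "adj u v"
proof -
  obtain a b where ab: "a \<in> S" "b \<in> V" "b \<notin> S" using assms by blast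
  have "(a, b) \<in> (adj_rel (underlying \<Gamma>))\<^sup>*"
    using connected ab assms(1) unfolding connected_graph_def by blast
  then have "b \<in> S \<or> (\<exists>u v. u \<in> S \<and> v \<notin> S \<and> adj u v)"
    by (induction rule: rtrancl_induct) (use ab in blast)+
  then show ?thesis using that ab adj_V by metis
qed

text \<open>Removing the pendant edge at \<open>f i\<close> leaves a path on the other four vertices of the cycle.\<close>

lemma nullity_of_five_cycle_with_attachment:
  assumes k: "k = 5" and "V \<noteq> T"
  shows "nullity \<Gamma> + 6 \<le> graph_order \<Gamma>"
proof -
  obtain i x where x: "x \<notin> T" "adj (f i) x"
    using exists_boundary_edge[OF T_V] assms(2) by (metis UNIV_not_empty image_is_empty rangeE)
  show ?thesis
  proof (rule nullity_le_of_pendant_triple)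
    have "distinct (map f [i..<Suc (i + 4)])" using arc(1)[of i "i + 4"] k by simp
    moreover have "[i..<Suc (i + 4)] = [i, i + 1, i + 2, i + 3, i + 4]" by (simp add: upt_rec)
    ultimately have d: "distinct [f i, f (i + 1), f (i + 2), f (i + 3), f (i + 4)]"
      by (simp only: list.map)
    then show "distinct [x, f i, f (i + 1), f (i + 2), f (i + 3), f (i + 4)]" using x(1) by auto
    show "adj x (f i)" using x(2) by (rule adj_sym)
    then have "\<not> adj x (f j)" if "f j \<noteq> f i" for j using attached_once[OF x(1) _ _ rangeI rangeI] that by blast
    then show "\<not> adj x (f (i + 1))" "\<not> adj x (f (i + 2))" "\<not> adj x (f (i + 3))" "\<not> adj x (f (i + 4))"
      using d by auto
    show "adj (f (i + 1)) (f (i + 2))" "adj (f (i + 3)) (f (i + 4))"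
      using adj_f[of "i + 1"] adj_f[of "i + 3"] by (simp_all add: add.commute)
  qed (rule chordless; use k in simp)+
qed

lemma graph_iso_cycle_graph:
  assumes "V = T"
  shows "graph_iso (underlying \<Gamma>) (cycle_graph k)"
proof -
  have "e \<in> range (\<lambda>i. {f i, f (Suc i)})" if e: "e \<in> edges (underlying \<Gamma>)" for e
  proof -
    obtain u v where uv: "u \<in> V" "v \<in> V" "e = {u, v}" using simple e unfolding simple_graph_def by blast
    then obtain i where i: "u = f i" using assms by blast
    obtain d where d: "d < k" "v = f (i + d)" using from_offset[of v i] uv(2) assms by metis
    have "d \<noteq> 0"
    proof
      assume "d = 0"
      then show False using e uv i d adj_irrefl[of u] by simp
    qed
    then consider "d = 1" | "Suc d = k"
      using chordless[of i "i + d"] d e uv i by fastforce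
    then show ?thesis
    proof cases
      case 1
      then show ?thesis using uv i d by auto
    next
      case 2
      then have "f (Suc (i + d)) = u" using f_period[of i] i by (metis add_Suc_right)
      then show ?thesis using uv(3) d(2) by (auto simp: insert_commute intro!: image_eqI[of _ _ "i + d"])
    qed
  qed
  then have "edges (underlying \<Gamma>) = range (\<lambda>i. {f i, f (Suc i)})" using adj_f by blast
  then show ?thesis using graph_iso_cycle_graph_iff[OF simple k3] cycle assms by blast
qed

lemma triangle:
  assumes "k = 3" "t \<in> T"
  obtains b c where "T = {t, b, c}" "distinct [t, b, c]" "adj t b" "adj b c" "adj t c"
proof -
  obtain i where i: "t = f i" using assms(2) by blast
  have "T = {t, f (i + 1), f (i + 2)}"
  proof
    show "T \<subseteq> {t, f (i + 1), f (i + 2)}"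
    proof
      fix u assume "u \<in> T"
      then obtain d where d: "d < k" "u = f (i + d)" using from_offset by metis
      then have "d = 0 \<or> d = 1 \<or> d = 2" using assms(1) by auto
      then show "u \<in> {t, f (i + 1), f (i + 2)}" using d i by auto
    qed
  qed (use i in auto)
  moreover have "distinct [t, f (i + 1), f (i + 2)]"
    using f_neq[of i "i + 1"] f_neq[of i "i + 2"] f_neq[of "i + 1" "i + 2"] assms(1) i by simp
  moreover have "adj t (f (i + 1))" "adj (f (i + 1)) (f (i + 2))" "adj t (f (i + 2))"
    using adj_f[of i] adj_f[of "i + 1"] adj_f[of "i + 2"] f_period[of i] assms(1) i
    by (simp_all add: insert_commute numeral_3_eq_3)
  ultimately show ?thesis by (rule that)
qed

definition "first_layer = {x \<in> V - T. \<exists>t\<in>T. adj x t}"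

lemma closed_through_outside:
  assumes "distinct xs" "3 \<le> length xs" "successively adj xs" "adj (last xs) (hd xs)" "x \<in> set xs"
  shows "x \<in> T"
  using cycle_list(1)[OF assms(1-4)] assms(5) by simp

lemma first_layer_independent:
  assumes k: "k = 3" and x: "x \<in> first_layer" and y: "y \<in> first_layer"
  shows "\<not> adj x y"
proof
  assume xy: "adj x y"
  obtain s t where st: "s \<in> T" "t \<in> T" "adj x s" "adj y t" and out: "x \<notin> T" "y \<notin> T"
    using x y by (auto simp: first_layer_def)
  have "x \<noteq> y" using xy adj_irrefl by auto
  show False
  proof (cases "s = t")
    case True
    have "x \<in> T"
      by (rule closed_through_outside[of "[x, y, t]"])
         (use st out xy \<open>x \<noteq> y\<close> True adj_sym[of x t] in auto)
    then show False using out by simp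
  next
    case False
    obtain b c where "T = {t, b, c}" "adj t b" "adj t c" by (rule triangle[OF k st(2)])
    then have "adj t s" using st(1) False by auto
    have "x \<in> T"
      by (rule closed_through_outside[of "[x, y, t, s]"])
         (use st out xy \<open>x \<noteq> y\<close> False adj_sym[of x s] \<open>adj t s\<close> in auto)
    then show False using out by simp
  qed
qed

text \<open>How far the trees hanging off the triangle reach decides the case. Whenever three disjoint pendant
  edges can be peeled off, the rank is at least \<open>6\<close>; the obstacles are trees of height one at
  two or fewer triangle vertices, where a vertex cover bounds the rank by \<open>4\<close>, and a single star hung
  up at a leaf, which is the shape of \<open>U4\<close>.\<close>

lemma triangle_trichotomy:
  assumes k: "k = 3"
  shows "nullity \<Gamma> + 6 \<le> graph_order \<Gamma> \<or> graph_order \<Gamma> \<le> nullity \<Gamma> + 4 \<or>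
    (\<exists>a b c d L. U4_shaped (underlying \<Gamma>) a b c d L)"
proof (cases "V = T \<union> first_layer")
  case True
  show ?thesis
  proof (cases "\<forall>t\<in>T. \<exists>x\<in>first_layer. adj x t")
    case priv: True
    obtain a b c where abc: "T = {a, b, c}" "distinct [a, b, c]"
      by (rule triangle[OF k, of "f 0"]) auto
    obtain x y z where xyz: "x \<in> first_layer" "adj x a" "y \<in> first_layer" "adj y b" "z \<in> first_layer" "adj z c"
      using priv abc(1) by (metis insertI1 insertI2)
    have out: "x \<notin> T" "y \<notin> T" "z \<notin> T" using xyz by (auto simp: first_layer_def)
    have one: "t = a" if "adj x t" "t \<in> T" for t
      using attached_once[OF out(1) xyz(2) that(1)] abc that by auto
    have two: "t = b" if "adj y t" "t \<in> T" for t
      using attached_once[OF out(2) xyz(4) that(1)] abc that by auto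
    have three: "t = c" if "adj z t" "t \<in> T" for t
      using attached_once[OF out(3) xyz(6) that(1)] abc that by auto
    have ne: "x \<noteq> y" "x \<noteq> z" "y \<noteq> z"
      using one[of b] one[of c] two[of c] abc xyz by auto
    have "nullity \<Gamma> + 6 \<le> graph_order \<Gamma>"
    proof (rule nullity_le_of_pendant_triple[of x a y b z c])
      show "distinct [x, a, y, b, z, c]" using abc out ne by auto
      show "\<not> adj x y" "\<not> adj x z" "\<not> adj y z" using first_layer_independent[OF k] xyz by auto
      show "\<not> adj x b" "\<not> adj x c" "\<not> adj y c" using one two abc by auto
    qed (use xyz in auto)
    then show ?thesis by simp
  next
    case False
    then obtain c where c: "c \<in> T" "\<And>x. x \<in> first_layer \<Longrightarrow> \<not> adj x c" by blast
    obtain a b where abc: "T = {c, a, b}" "distinct [c, a, b]" by (rule triangle[OF k c(1)])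
    \<comment> \<open>A triangle vertex \<open>c\<close> without further neighbours leaves \<open>{a, b}\<close> as a vertex cover.\<close>
    have "graph_order \<Gamma> \<le> nullity \<Gamma> + 2 * card {a, b}"
    proof (rule nullity_ge_of_vertex_cover[OF signed])
      fix u v assume uv: "adj u v"
      have uvV: "u \<in> V" "v \<in> V" using adj_V uv by auto
      show "u \<in> {a, b} \<or> v \<in> {a, b}"
      proof (rule ccontr)
        assume "\<not> ?thesis"
        then have "u = c \<or> u \<in> first_layer" "v = c \<or> v \<in> first_layer" using uvV True abc by auto
        then show False
          using first_layer_independent[OF k] c(2) uv adj_sym[OF uv] adj_irrefl by metis
      qed
    qed simp
    then show ?thesis using abc by simp
  qed
next
  case False
  define second_layer where "second_layer = {y \<in> V - T - first_layer. \<exists>x\<in>first_layer. adj y x}"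
  have first_layer: "x \<in> V" "x \<notin> T" if "x \<in> first_layer" for x using that by (auto simp: first_layer_def)
  have second_layer: "y \<in> V" "y \<notin> T" "y \<notin> first_layer" "\<And>t. t \<in> T \<Longrightarrow> \<not> adj y t" if "y \<in> second_layer" for y
    using that by (auto simp: second_layer_def first_layer_def)
  show ?thesis
  proof (cases "V = T \<union> first_layer \<union> second_layer")
    case V: False
    \<comment> \<open>Some vertex \<open>z\<close> has distance three; connectedness provides one next to the second layer.\<close>
    have "T \<union> first_layer \<union> second_layer \<subseteq> V" using T_V by (auto simp: first_layer_def second_layer_def)
    then obtain y z where yz: "y \<in> T \<union> first_layer \<union> second_layer" "z \<in> V" "z \<notin> T \<union> first_layer \<union> second_layer" "adj y z"
      using exists_boundary_edge[OF _ _ V[symmetric]] by blast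
    have z: "\<not> adj z t" if "t \<in> T \<union> first_layer" for t using that yz by (auto simp: first_layer_def second_layer_def)
    then have y: "y \<in> second_layer" using yz(1) adj_sym[OF yz(4)] by auto
    then obtain x where x: "x \<in> first_layer" "adj y x" by (auto simp: second_layer_def)
    then obtain t where t: "t \<in> T" "adj x t" by (auto simp: first_layer_def)
    obtain b c where T: "T = {t, b, c}" "distinct [t, b, c]" "adj b c" by (rule triangle[OF k t(1)])
    have "nullity \<Gamma> + 6 \<le> graph_order \<Gamma>"
    proof (rule nullity_le_of_pendant_triple[of z y x t b c])
      show "distinct [z, y, x, t, b, c]" using yz(3) y second_layer[OF y] first_layer[OF x(1)] x T by auto
      show "adj z y" by (rule adj_sym[OF yz(4)])
      show "\<not> adj z x" "\<not> adj z t" "\<not> adj z b" "\<not> adj z c" using z x(1) T(1) by auto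
      show "\<not> adj x b" "\<not> adj x c"
        using attached_once[OF first_layer(2)[OF x(1)] t(2)] t(1) T by auto
    qed (use t T in auto)
    then show ?thesis by simp
  next
    case V: True
    then obtain y where y: "y \<in> second_layer" using False by auto
    then obtain x where x: "x \<in> first_layer" "adj y x" by (auto simp: second_layer_def)
    then obtain t where t: "t \<in> T" "adj x t" by (auto simp: first_layer_def)
    obtain b c where T: "T = {t, b, c}" "distinct [t, b, c]" "adj t b" "adj b c" "adj t c"
      by (rule triangle[OF k t(1)])
    show ?thesis
    proof (cases "first_layer = {x}")
      case single: False
      then obtain x' where x': "x' \<in> first_layer" "x' \<noteq> x" using x(1) by auto
      then obtain t' where t': "t' \<in> T" "adj x' t'" by (auto simp: first_layer_def)
      note out = first_layer(2)[OF x(1)] first_layer(2)[OF x'(1)] second_layer(2,3)[OF y]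
      \<comment> \<open>A common neighbour \<open>y\<close> of two first-layer vertices would close a cycle through the triangle.\<close>
      have yx': "\<not> adj y x'"
      proof
        assume yx': "adj y x'"
        show False
        proof (cases "t = t'")
          case True
          have "y \<in> T"
            by (rule closed_through_outside[of "[y, x, t, x']"])
               (use x x' t t' out True yx' adj_sym[OF yx'] adj_sym[OF t'(2)] in auto)
          then show False using out by simp
        next
          case False
          then have "adj t t'" using T t' by auto
          have "y \<in> T"
            by (rule closed_through_outside[of "[y, x, t, t', x']"])
               (use x x' t t' out False yx' \<open>adj t t'\<close> adj_sym[OF yx'] adj_sym[OF t'(2)] in auto)
          then show False using out by simp
        qed
      qed
      obtain p q where pq: "T = {t', p, q}" "distinct [t', p, q]" "adj p q"
        by (rule triangle[OF k t'(1)])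
      have "nullity \<Gamma> + 6 \<le> graph_order \<Gamma>"
      proof (rule nullity_le_of_pendant_triple[of y x x' t' p q])
        show "distinct [y, x, x', t', p, q]" using out x x' pq by auto
        show "\<not> adj y x'" by (rule yx')
        show "\<not> adj y t'" "\<not> adj y p" "\<not> adj y q" using second_layer(4)[OF y] pq(1) by auto
        show "\<not> adj x' p" "\<not> adj x' q"
          using attached_once[OF out(2) t'(2)] t'(1) pq by auto
      qed (use x t' pq in auto)
      then show ?thesis by simp
    next
      case single: True
      note out = first_layer(2)[OF x(1)]
      have yx: "adj y x" if "y \<in> second_layer" for y using that single by (auto simp: second_layer_def)
      have second_layer_indep: "\<not> adj p q" if pq: "p \<in> second_layer" "q \<in> second_layer" for p q
      proof
        assume a: "adj p q"
        have "p \<noteq> q" using a adj_irrefl by auto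
        have "x \<in> T"
          by (rule closed_through_outside[of "[x, p, q]"])
             (use a pq second_layer(3) x yx \<open>p \<noteq> q\<close> adj_sym[OF yx] in auto)
        then show False using out by simp
      qed
      have xb: "\<not> adj x b" "\<not> adj x c" using attached_once[OF out t(2)] t(1) T by auto
      have "edges (underlying \<Gamma>) = {{t, b}, {b, c}, {t, c}, {t, x}} \<union> (\<lambda>y. {x, y}) ` second_layer" (is "?E = ?F")
      proof
        show "?F \<subseteq> ?E" using T t(2) adj_sym yx by auto
        have VN: "p \<in> T \<or> p = x \<or> p \<in> second_layer" if "p \<in> V" for p using that V single by blast
        have touching_T: "{u, v} \<in> ?F" if uv: "adj u v" and u: "u \<in> T" for u v
          using VN[OF adj_V(2)[OF uv]]
        proof (elim disjE)
          assume v: "v \<in> T"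
          have "u \<noteq> v" using uv adj_irrefl by auto
          then have "{u, v} = {t, b} \<or> {u, v} = {b, c} \<or> {u, v} = {t, c}"
            using u v unfolding T(1) by (auto simp: insert_commute)
          then show ?thesis by blast
        next
          assume v: "v = x"
          then have "u = t" using xb adj_sym[OF uv] u T(1) by auto
          then show ?thesis using v by simp
        next
          assume "v \<in> second_layer"
          then show ?thesis using second_layer(4) adj_sym[OF uv] u by blast
        qed
        have in_F: "{u, v} \<in> ?F" if uv: "adj u v" for u v
        proof (cases "u \<in> T \<or> v \<in> T")
          case True
          then show ?thesis
            using touching_T[OF uv] touching_T[OF adj_sym[OF uv]] by (metis insert_commute)
        next
          case False
          then have "u = x \<or> u \<in> second_layer" "v = x \<or> v \<in> second_layer" using VN adj_V[OF uv] by blast+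
          moreover have "\<not> (u = x \<and> v = x)" using uv adj_irrefl by auto
          moreover have "\<not> (u \<in> second_layer \<and> v \<in> second_layer)" using second_layer_indep uv by blast
          ultimately have "u = x \<and> v \<in> second_layer \<or> v = x \<and> u \<in> second_layer" by blast
          then show ?thesis by (auto simp: insert_commute)
        qed
        show "?E \<subseteq> ?F"
        proof
          fix e assume e: "e \<in> ?E"
          then obtain u v where "e = {u, v}" using simple unfolding simple_graph_def by metis
          then show "e \<in> ?F" using in_F e by metis
        qed
      qed
      moreover have "finite second_layer" using finite_V second_layer(1) by (meson finite_subset subsetI)
      moreover have "x \<notin> {t, b, c}" using out T(1) by auto
      moreover have "second_layer \<inter> {t, b, c, x} = {}" using second_layer(2,3) T(1) x(1) by auto
      ultimately have "U4_shaped (underlying \<Gamma>) t b c x second_layer"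
        using T(1,2) V single y unfolding U4_shaped_def by auto
      then show ?thesis by blast
    qed
  qed
qed

text \<open>The triangle and a pendant edge \<open>y d\<close> form a nonsingular submatrix of size \<open>5\<close>. Conversely the rows
  of \<open>a\<close>, \<open>b\<close>, \<open>c\<close>, \<open>d\<close> and a single leaf \<open>y\<close> span all rows, as a leaf is adjacent to \<open>d\<close> only.\<close>

lemma nullity_of_U4_shaped:
  assumes U: "U4_shaped (underlying \<Gamma>) a b c d L"
  shows "nullity \<Gamma> + 5 = graph_order \<Gamma>"
proof (rule antisym)
  note U = U[unfolded U4_shaped_def]
  have "L \<noteq> {}" using U by simp
  then obtain y where y: "y \<in> L" by blast
  have E: "adj u v \<longleftrightarrow> {u, v} \<in> {{a, b}, {b, c}, {a, c}, {a, d}} \<union> (\<lambda>y. {d, y}) ` L" for u v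
    using U by simp
  have abc: "distinct [a, b, c]" using U by simp
  have dy: "d \<notin> {a, b, c}" "y \<notin> {a, b, c, d}" using U y by auto
  have "set [a, b, c] = T" "length [a, b, c] = k"
    by (rule cycle_list; use abc E in \<open>auto simp: insert_commute\<close>)+
  then have "nonsingular_on \<Gamma> {a, b, c}" using nonsingular_on_odd_cycle by auto
  moreover have "adj y d" using y E by (auto simp: insert_commute)
  moreover have "\<not> adj y v" if "v \<in> {a, b, c}" for v
    using that dy U y by (auto simp: E doubleton_eq_iff)
  ultimately have "nonsingular_on \<Gamma> (insert y (insert d {a, b, c}))"
    using dy adj_irrefl[of y] by (intro nonsingular_on_pendant[of "{a, b, c}" \<Gamma> y d]) auto
  then have "nullity \<Gamma> + card (insert y (insert d {a, b, c})) \<le> graph_order \<Gamma>"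
    using U y by (intro nullity_le_of_nonsingular_on[OF signed]) auto
  then show "nullity \<Gamma> + 5 \<le> graph_order \<Gamma>" using dy abc by simp
  define W where "W = {a, b, c, d}"
  define g where "g l u = (if l = y then (if u \<in> L then weight \<Gamma> u d else 0) else if u = l then 1 else 0)" for l u
  define h where "h l v = (if l = y then (if v = d then 1 else 0) else weight \<Gamma> l v)" for l v
  have yW: "y \<notin> W" "finite W" "W \<inter> L = {}" using U y by (auto simp: W_def)
  have "weight \<Gamma> u v = (\<Sum>l\<in>insert y W. g l u * h l v)" if uv: "u \<in> V" "v \<in> V" for u v
  proof -
    have "(\<Sum>l\<in>insert y W. g l u * h l v) = g y u * h y v + (\<Sum>l\<in>W. if u = l then weight \<Gamma> l v else 0)"
    proof -
      have "(\<Sum>l\<in>W. g l u * h l v) = (\<Sum>l\<in>W. if u = l then weight \<Gamma> l v else 0)"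
        using yW(1) by (intro sum.cong) (auto simp: g_def h_def)
      then show ?thesis using yW(1,2) by simp
    qed
    also have "(\<Sum>l\<in>W. if u = l then weight \<Gamma> l v else 0) = (if u \<in> W then weight \<Gamma> u v else 0)"
      using yW by simp
    also have "g y u * h y v = (if u \<in> L \<and> v = d then weight \<Gamma> u d else 0)"
      by (simp add: g_def h_def)
    also have "\<dots> + (if u \<in> W then weight \<Gamma> u v else 0) = weight \<Gamma> u v"
    proof (cases "u \<in> W")
      case True
      then show ?thesis using yW by auto
    next
      case False
      then have "u \<in> L" using uv U by (auto simp: W_def)
      moreover have "\<not> adj u v" if "v \<noteq> d"
        using that False \<open>u \<in> L\<close> by (auto simp: E W_def doubleton_eq_iff)
      ultimately show ?thesis using False by (auto simp: weight_eq_0_iff)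
    qed
    finally show ?thesis by simp
  qed
  then have "graph_order \<Gamma> \<le> nullity \<Gamma> + card (insert y W)"
    using yW by (intro nullity_ge_of_factorization[OF signed]) auto
  also have "card (insert y W) = 5" using yW U by (simp add: W_def)
  finally show "graph_order \<Gamma> \<le> nullity \<Gamma> + 5" .
qed

end

section \<open>Recognising \<open>U4\<close>\<close>

lemma simple_graph_of_U4_shaped:
  assumes "U4_shaped G a b c d L"
  shows "simple_graph G"
proof -
  define P where "P e \<longleftrightarrow> (\<exists>u\<in>verts G. \<exists>v\<in>verts G. u \<noteq> v \<and> e = {u, v})" for e
  have P: "P {u, v}" if "u \<in> verts G" "v \<in> verts G" "u \<noteq> v" for u v
    unfolding P_def using that by blast
  have V: "a \<in> verts G" "b \<in> verts G" "c \<in> verts G" "d \<in> verts G" "L \<subseteq> verts G"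
    and ne: "a \<noteq> b" "b \<noteq> c" "a \<noteq> c" "a \<noteq> d" "d \<notin> L"
    using assms by (auto simp: U4_shaped_def)
  have "P {a, b}" "P {b, c}" "P {a, c}" "P {a, d}" using P V ne by simp_all
  moreover have "P {d, y}" if "y \<in> L" for y using P[of d y] V that ne(5) by blast
  ultimately have "\<forall>e\<in>edges G. P e" using assms by (auto simp: U4_shaped_def)
  moreover have "finite (verts G)" using assms by (simp add: U4_shaped_def)
  ultimately show ?thesis by (simp add: simple_graph_def P_def)
qed

text \<open>The merged vertex is \<open>Inl 0\<close>, which also stands for the leaf \<open>1\<close> of the star; this leaves the star
  centre \<open>Inr 0\<close> and the leaves \<open>2, \<dots>, r + 1\<close>.\<close>

lemma U4_shaped_U4:
  assumes "1 \<le> r"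
  shows "U4_shaped (U4 r) (Inl 0) (Inl 1) (Inl 2) (Inr 0) (Inr ` {2..r + 1})"
proof -
  define g :: "nat \<Rightarrow> nat + nat" where "g y = (if y = 1 then Inl 0 else Inr y)" for y
  define S where "S = {2..r + 1}"
  have split: "{0..r + 1} = insert 0 (insert 1 S)" by (auto simp: S_def)
  have "{{0, i} | i. 1 \<le> i \<and> i \<le> r + 1} = (\<lambda>i. {0, i}) ` {1..r + 1}" by auto
  also have "{1..r + 1} = insert 1 S" by (auto simp: S_def)
  finally have star: "{{0, i} | i. 1 \<le> i \<and> i \<le> r + 1} = insert {1, 0} ((\<lambda>i. {0, i}) ` S)"
    by (simp add: insert_commute)
  have tri: "{{i, Suc i mod 3} | i. i < 3} = {{0, 1}, {1, 2}, {0, 2 :: nat}}"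
  proof -
    have "{i. i < 3} = {0, 1, 2 :: nat}" by auto
    then show ?thesis by (simp add: setcompr_eq_image insert_commute numeral_2_eq_2)
  qed
  have g: "g ` S = Inr ` S" by (intro image_cong) (auto simp: g_def S_def)
  have ge: "(\<lambda>e. g ` e) ` (\<lambda>i. {0, i}) ` S = (\<lambda>y. {Inr 0, y}) ` Inr ` S"
    unfolding image_image by (intro image_cong) (auto simp: g_def S_def)
  have U: "U4 r = \<lparr>verts = Inl ` {0..<3} \<union> g ` {0..r + 1},
      edges = (\<lambda>e. Inl ` e) ` {{i, Suc i mod 3} | i. i < 3} \<union>
        (\<lambda>e. g ` e) ` {{0, i} | i. 1 \<le> i \<and> i \<le> r + 1}\<rparr>"
    by (simp add: U4_def identify_vertices_def Let_def g_def[abs_def] cycle_graph_def star_graph_def)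
  have three: "{0..<3} = {0, 1, 2 :: nat}" by auto
  have g01: "g 0 = Inr 0" "g 1 = Inl 0" by (simp_all add: g_def)
  have V: "verts (U4 r) = {Inl 0, Inl 1, Inl 2, Inr 0} \<union> Inr ` S"
    unfolding U split three ugraph.select_convs image_insert image_empty g g01 by blast
  have "(\<lambda>e. g ` e) ` insert {1, 0} ((\<lambda>i. {0, i}) ` S)
      = insert {Inl 0, Inr 0} ((\<lambda>y. {Inr 0, y}) ` Inr ` S)"
    unfolding image_insert ge image_empty g01 ..
  then have E: "edges (U4 r) = {{Inl 0, Inl 1}, {Inl 1, Inl 2}, {Inl 0, Inl 2}, {Inl 0, Inr 0}} \<union>
      (\<lambda>y. {Inr 0, y}) ` Inr ` S"
    unfolding U star tri by (simp only: ugraph.select_convs image_insert image_empty Un_insert_left Un_empty_left)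
  have "finite S" "S \<noteq> {}" "0 \<notin> S" using assms by (auto simp: S_def)
  then show ?thesis unfolding U4_shaped_def V E S_def[symmetric] by auto
qed

lemma U4_shaped_image:
  assumes h: "bij_betw h (verts H) (verts G)" "edges G = (\<lambda>e. h ` e) ` edges H"
    and U: "U4_shaped H a b c d L"
  shows "U4_shaped G (h a) (h b) (h c) (h d) (h ` L)"
proof -
  note U = U[unfolded U4_shaped_def]
  have V: "{a, b, c, d} \<subseteq> verts H" "L \<subseteq> verts H" using U by auto
  have inj: "h x = h y \<longleftrightarrow> x = y" if "x \<in> verts H" "y \<in> verts H" for x y
    using inj_on_eq_iff[OF bij_betw_imp_inj_on[OF h(1)] that] .
  have "h ` verts H = verts G" using h(1) by (rule bij_betw_imp_surj_on)
  then have "verts G = {h a, h b, h c, h d} \<union> h ` L" using U by (simp add: image_Un)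
  moreover have "edges G = {{h a, h b}, {h b, h c}, {h a, h c}, {h a, h d}} \<union> (\<lambda>y. {h d, y}) ` h ` L"
    using U unfolding h(2) by (simp add: image_Un image_image)
  moreover have "h ` L \<inter> {h a, h b, h c, h d} = {}"
    using inj_on_image_Int[OF bij_betw_imp_inj_on[OF h(1)] V(2,1)] U by simp
  moreover have "distinct [h a, h b, h c, h d]" using U V(1) by (auto simp: inj)
  ultimately show ?thesis using U unfolding U4_shaped_def by simp
qed

lemma U4_shaped_iso:
  assumes U: "U4_shaped G a b c d L" and U': "U4_shaped H a' b' c' d' L'" and card: "card L' = card L"
  shows "graph_iso G H"
proof -
  note G = U[unfolded U4_shaped_def] and H = U'[unfolded U4_shaped_def]
  obtain h0 where h0: "bij_betw h0 L' L"
    using finite_same_card_bij[of L' L] G H card by auto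
  define h where "h = h0(a' := a, b' := b, c' := c, d' := d)"
  have h: "h a' = a" "h b' = b" "h c' = c" "h d' = d" using H by (auto simp: h_def)
  have hL: "h y = h0 y" if "y \<in> L'" for y using H that by (auto simp: h_def)
  have L: "bij_betw h L' L" using h0 bij_betw_cong[of L' h h0 L] hL by blast
  have "bij_betw h {a', b', c', d'} {a, b, c, d}" using G H h by (auto simp: bij_betw_def)
  then have "bij_betw h (verts H) (verts G)"
    using bij_betw_combine[OF _ L] G H by (metis Int_commute)
  moreover have "edges G = (\<lambda>e. h ` e) ` edges H"
  proof -
    have "(\<lambda>e. h ` e) ` (\<lambda>y. {d', y}) ` L' = (\<lambda>y. {d, y}) ` h ` L'"
      by (simp add: image_image h)
    then show ?thesis using G H h bij_betw_imp_surj_on[OF L] by (simp add: image_Un)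
  qed
  ultimately show ?thesis
    using graph_iso_iff_edges_image[OF simple_graph_of_U4_shaped[OF U] simple_graph_of_U4_shaped[OF U']]
    by blast
qed

lemma graph_iso_U4_iff:
  assumes G: "simple_graph G"
  shows "(\<exists>r\<ge>1. graph_iso G (U4 r)) \<longleftrightarrow> (\<exists>a b c d L. U4_shaped G a b c d L)"
proof
  assume "\<exists>r\<ge>1. graph_iso G (U4 r)"
  then obtain r where r: "1 \<le> r" "graph_iso G (U4 r)" by blast
  note U = U4_shaped_U4[OF r(1)]
  obtain h where "bij_betw h (verts (U4 r)) (verts G)" "edges G = (\<lambda>e. h ` e) ` edges (U4 r)"
    using r(2) graph_iso_iff_edges_image[OF G simple_graph_of_U4_shaped[OF U]] by auto
  from U4_shaped_image[OF this U] show "\<exists>a b c d L. U4_shaped G a b c d L" by blast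
next
  assume "\<exists>a b c d L. U4_shaped G a b c d L"
  then obtain a b c d L where U: "U4_shaped G a b c d L" by blast
  have "finite L" "L \<noteq> {}" using U by (simp_all add: U4_shaped_def)
  then have r: "1 \<le> card L" by (simp add: Suc_le_eq card_gt_0_iff)
  have "card (Inr ` {2..card L + 1} :: (nat + nat) set) = card L" by (simp add: card_image)
  then have "graph_iso G (U4 (card L))" by (rule U4_shaped_iso[OF U U4_shaped_U4[OF r]])
  then show "\<exists>r\<ge>1. graph_iso G (U4 r)" using r by blast
qed


section \<open>The classification\<close>

text \<open>A periodic cycle sequence spans a subgraph isomorphic to a cycle graph, so the uniqueness of that
  subgraph carries over to the vertex sets of such sequences.\<close>

lemma unicyclic_signed_graph_of_unicyclic:
  assumes G: "signed_graph \<Gamma>" and U: "unicyclic \<Gamma>"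
  shows "\<exists>k f. unicyclic_signed_graph \<Gamma> k f"
proof -
  let ?G = "underlying \<Gamma>"
  let ?C = "\<lambda>C. subgraph_of C ?G \<and> (\<exists>m\<ge>3. graph_iso C (cycle_graph m))"
  have simple: "simple_graph ?G" using G by (simp add: signed_graph_def)
  have conn: "connected_graph ?G" and ex1: "\<exists>!C. ?C C"
    using U unfolding unicyclic_def by (rule conjunct1, rule conjunct2)
  have as_subgraph: "?C \<lparr>verts = range g, edges = range (\<lambda>i. {g i, g (Suc i)})\<rparr>"
    if g: "cycle_in ?G l g" for l g
  proof -
    let ?C = "\<lparr>verts = range g, edges = range (\<lambda>i. {g i, g (Suc i)})\<rparr>"
    have e: "{g i, g (Suc i)} \<in> edges ?G" for i using g by (simp add: cycle_in_def)
    have s: "simple_graph ?C"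
    proof -
      have "finite (range g)" using cycle_in_range(1)[OF g] by simp
      moreover have "\<exists>u\<in>range g. \<exists>v\<in>range g. u \<noteq> v \<and> {g i, g (Suc i)} = {u, v}" for i
        using edge_in_verts(3)[OF simple e[of i]] by blast
      ultimately show ?thesis by (auto simp: simple_graph_def)
    qed
    moreover have "range g \<subseteq> verts ?G" using edge_in_verts(1)[OF simple e] by auto
    ultimately have "subgraph_of ?C ?G" using e by (auto simp: subgraph_of_def)
    moreover have l: "3 \<le> l" using g by (simp add: cycle_in_def)
    have "cycle_in ?C l g" using g by (simp add: cycle_in_def)
    then have "graph_iso ?C (cycle_graph l)"
      unfolding graph_iso_cycle_graph_iff[OF s l] by (intro exI[of _ g]) simp
    ultimately show ?thesis using l by (intro conjI exI[of _ l]) simp_all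
  qed
  obtain C where C: "?C C" and C_unique: "\<And>D. ?C D \<Longrightarrow> D = C" using ex1 by (elim ex1E) blast
  have range_eq: "range g = verts C" if "cycle_in ?G l g" for l g
    using arg_cong[OF C_unique[OF as_subgraph[OF that]], of verts] by simp
  obtain m where m: "3 \<le> m" "graph_iso C (cycle_graph m)" using C by blast
  have sub: "simple_graph C" "edges C \<subseteq> edges ?G" using C by (simp_all add: subgraph_of_def)
  obtain f where "cycle_in C m f"
    using m graph_iso_cycle_graph_iff[OF sub(1) m(1)] by blast
  then have f: "cycle_in ?G m f" using sub(2) unfolding cycle_in_def by blast
  have "range g = range f" if "cycle_in ?G l g" for l g
    using range_eq[OF that] range_eq[OF f] by simp
  then have "unicyclic_signed_graph \<Gamma> m f"
    by (rule unicyclic_signed_graph.intro[OF simple conn f])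
  then show ?thesis by blast
qed

theorem theorem3p4:
  fixes \<Gamma> :: "'a signed_graph" and n :: nat
  assumes "signed_graph \<Gamma>"
    and "unicyclic \<Gamma>"
    and "graph_order \<Gamma> = n"
    and "n \<ge> 5"
  shows "nullity \<Gamma> = n - 5 \<longleftrightarrow>
    (graph_iso (underlying \<Gamma>) (cycle_graph 5) \<or>
     (\<exists>r \<ge> 1. graph_iso (underlying \<Gamma>) (U4 r)))"
proof -
  obtain k f where "unicyclic_signed_graph \<Gamma> k f"
    using unicyclic_signed_graph_of_unicyclic[OF assms(1,2)] by (elim exE)
  then interpret unicyclic_signed_graph \<Gamma> k f .
  note n = assms(3,4)
  show ?thesis
  proof
    assume null: "nullity \<Gamma> = n - 5"
    have "odd k"
    proof
      assume "even k"
      then show False using nullity_parity_of_even_cycle null n by (auto simp: even_diff_nat)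
    qed
    moreover have "k < 7" using nullity_of_long_cycle null n by (cases "k < 7") auto
    ultimately have "k = 3 \<or> k = 5" using k3 by presburger
    then show "graph_iso (underlying \<Gamma>) (cycle_graph 5) \<or> (\<exists>r\<ge>1. graph_iso (underlying \<Gamma>) (U4 r))"
    proof
      assume "k = 3"
      then have "\<exists>a b c d L. U4_shaped (underlying \<Gamma>) a b c d L"
        using triangle_trichotomy null n by auto
      then show ?thesis using graph_iso_U4_iff[OF simple] by blast
    next
      assume k: "k = 5"
      then have "V = T" using nullity_of_five_cycle_with_attachment null n by fastforce
      then show ?thesis using graph_iso_cycle_graph k by simp
    qed
  next
    assume "graph_iso (underlying \<Gamma>) (cycle_graph 5) \<or> (\<exists>r\<ge>1. graph_iso (underlying \<Gamma>) (U4 r))"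
    then show "nullity \<Gamma> = n - 5"
    proof
      assume "graph_iso (underlying \<Gamma>) (cycle_graph 5)"
      then obtain g where g: "cycle_in (underlying \<Gamma>) 5 g" "V = range g"
        using graph_iso_cycle_graph_iff[OF simple, of 5] by auto
      have "V = T" using unique[OF g(1)] g(2) by simp
      moreover have k: "k = 5" using unique[OF g(1)] card_T cycle_in_range(2)[OF g(1)] by simp
      ultimately have "nullity \<Gamma> + card V \<le> graph_order \<Gamma>"
        using nullity_le_of_nonsingular_on[OF signed, of T] nonsingular_on_odd_cycle by simp
      then show ?thesis using n \<open>V = T\<close> card_T k by (simp add: order_eq)
    next
      assume "\<exists>r\<ge>1. graph_iso (underlying \<Gamma>) (U4 r)"
      then show ?thesis using graph_iso_U4_iff[OF simple] nullity_of_U4_shaped n by fastforce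
    qed
  qed
qed

end
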